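(* A set $E$ of permutations is a $\mathsf{TO(TO{+}OB)}$ set if and only if it belongs to the Boolean algebra (of subsets of the set of all permutations of all sizes) generated by all the sets $\mathcal{C}_\lambda$ and $\mathcal{D}_\lambda$, where $\lambda$ runs over all integer partitions.
   Context: $\mathsf{TOTO}$: a permutation $\sigma$ of size $n$ is viewed as the structure with domain $\{(i,\sigma(i)) : 1\le i\le n\}$ and two strict total orders $<_P$ (comparing first coordinates) and $<_V$ (comparing second coordinates); $\mathsf{TOTO}$ sentences are first-order sentences (with equality) over $\{<_P,<_V\}$. $\mathsf{TOOB}$: the same permutation is viewed as the structure with domain $\{1,\dots,n\}$ and one binary relation $R$ with $iRj$ iff $\sigma(i)=j$; $\mathsf{TOOB}$ sentences are first-order sentences (with equality) over $\{R\}$. A set $E$ of permutations is a $\mathsf{TO(TO{+}OB)}$ set if there exist a $\mathsf{TOTO}$ sentence and a $\mathsf{TOOB}$ sentence each of whose sets of permutation models is exactly $E$. The cycle-type of a permutation is the integer partition of its cycle lengths (fixed points counting as parts equal to $1$). For a partition $\lambda$, $\mathcal{C}_\lambda$ is the set of permutations of cycle-type $\lambda$, and $\mathcal{D}_\lambda=\bigcup_{k\ge0}\mathcal{C}_{\lambda\cup(1^k)}$, where $\lambda\cup(1^k)$ is the partition obtained by adding $k$ parts equal to $1$ to $\lambda$. The Boolean algebra generated by a family of sets is the smallest collection containing the family and closed under finite unions, finite intersections and complements. *)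

theory Defs
  imports
    "HOL-Library.Multiset"
    "HOL-Combinatorics.Orbits"
    "HOL-Analysis.Sigma_Algebra"
begin

section \<open>First-order logic with equality over binary relation symbols\<close>

text \<open>The remaining connectives and the universal quantifier are classically definable.\<close>

datatype 'r fo =
    Eq nat nat
  | Rel 'r nat nat
  | Neg "'r fo"
  | Conj "'r fo" "'r fo"
  | Exists nat "'r fo"

primrec free_vars :: "'r fo \<Rightarrow> nat set" where
  "free_vars (Eq x y) = {x, y}"
| "free_vars (Rel r x y) = {x, y}"
| "free_vars (Neg \<phi>) = free_vars \<phi>"
| "free_vars (Conj \<phi> \<psi>) = free_vars \<phi> \<union> free_vars \<psi>"
| "free_vars (Exists x \<phi>) = free_vars \<phi> - {x}"

definition sentence :: "'r fo \<Rightarrow> bool" where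
  "sentence \<phi> \<longleftrightarrow> free_vars \<phi> = {}"

primrec holds :: "'a set \<Rightarrow> ('r \<Rightarrow> 'a \<Rightarrow> 'a \<Rightarrow> bool) \<Rightarrow> (nat \<Rightarrow> 'a) \<Rightarrow> 'r fo \<Rightarrow> bool" where
  "holds D I v (Eq x y) \<longleftrightarrow> v x = v y"
| "holds D I v (Rel r x y) \<longleftrightarrow> I r (v x) (v y)"
| "holds D I v (Neg \<phi>) \<longleftrightarrow> \<not> holds D I v \<phi>"
| "holds D I v (Conj \<phi> \<psi>) \<longleftrightarrow> holds D I v \<phi> \<and> holds D I v \<psi>"
| "holds D I v (Exists x \<phi>) \<longleftrightarrow> (\<exists>a\<in>D. holds D I (v(x := a)) \<phi>)"

text \<open>Satisfaction, used for sentences only, where the valuation is irrelevant. Valuations are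
  not required to take values in the domain, so that the empty domain needs no special treatment.\<close>

definition satisfies :: "'a set \<Rightarrow> ('r \<Rightarrow> 'a \<Rightarrow> 'a \<Rightarrow> bool) \<Rightarrow> 'r fo \<Rightarrow> bool" where
  "satisfies D I \<phi> \<longleftrightarrow> (\<forall>v. holds D I v \<phi>)"


section \<open>Permutations of all sizes\<close>

text \<open>The size is part of the data: \<open>\<sigma> permutes {1..n}\<close> extends \<open>\<sigma>\<close> by the identity outside
  \<open>{1..n}\<close>, so that \<open>\<sigma>\<close> alone does not determine \<open>n\<close>. The empty permutation is included.\<close>

definition perms :: "(nat \<times> (nat \<Rightarrow> nat)) set" where
  "perms = {(n, \<sigma>). \<sigma> permutes {1..n}}"

datatype toto_sym = LessP | LessV

definition toto_dom :: "nat \<Rightarrow> (nat \<Rightarrow> nat) \<Rightarrow> (nat \<times> nat) set" where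
  "toto_dom n \<sigma> = {(i, \<sigma> i) | i. i \<in> {1..n}}"

primrec toto_rel :: "toto_sym \<Rightarrow> nat \<times> nat \<Rightarrow> nat \<times> nat \<Rightarrow> bool" where
  "toto_rel LessP = (\<lambda>p q. fst p < fst q)"
| "toto_rel LessV = (\<lambda>p q. snd p < snd q)"

definition toto_models :: "toto_sym fo \<Rightarrow> (nat \<times> (nat \<Rightarrow> nat)) set" where
  "toto_models \<phi> = {(n, \<sigma>) \<in> perms. satisfies (toto_dom n \<sigma>) toto_rel \<phi>}"

datatype toob_sym = SymR

primrec toob_rel :: "(nat \<Rightarrow> nat) \<Rightarrow> toob_sym \<Rightarrow> nat \<Rightarrow> nat \<Rightarrow> bool" where
  "toob_rel \<sigma> SymR = (\<lambda>i j. \<sigma> i = j)"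

definition toob_models :: "toob_sym fo \<Rightarrow> (nat \<times> (nat \<Rightarrow> nat)) set" where
  "toob_models \<psi> = {(n, \<sigma>) \<in> perms. satisfies {1..n} (toob_rel \<sigma>) \<psi>}"

definition toto_toob_set :: "(nat \<times> (nat \<Rightarrow> nat)) set \<Rightarrow> bool" where
  "toto_toob_set E \<longleftrightarrow>
     (\<exists>\<phi>. sentence \<phi> \<and> toto_models \<phi> = E) \<and> (\<exists>\<psi>. sentence \<psi> \<and> toob_models \<psi> = E)"


section \<open>Cycle types\<close>

text \<open>Integer partitions are multisets of positive natural numbers, the empty one included.\<close>

definition integer_partition :: "nat multiset \<Rightarrow> bool" where
  "integer_partition \<mu> \<longleftrightarrow> 0 \<notin># \<mu>"

text \<open>The orbits form a set, so each cycle contributes its length exactly once.\<close>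

definition cycle_type :: "nat \<Rightarrow> (nat \<Rightarrow> nat) \<Rightarrow> nat multiset" where
  "cycle_type n \<sigma> = image_mset card (mset_set (orbit \<sigma> ` {1..n}))"

definition \<C> :: "nat multiset \<Rightarrow> (nat \<times> (nat \<Rightarrow> nat)) set" where
  "\<C> \<mu> = {(n, \<sigma>) \<in> perms. cycle_type n \<sigma> = \<mu>}"

definition \<D> :: "nat multiset \<Rightarrow> (nat \<times> (nat \<Rightarrow> nat)) set" where
  "\<D> \<mu> = (\<Union>k. \<C> (\<mu> + replicate_mset k 1))"


section \<open>Generated Boolean algebras of sets\<close>

definition generated_algebra :: "'a set \<Rightarrow> 'a set set \<Rightarrow> 'a set set" where
  "generated_algebra \<Omega> G = \<Inter>{M. algebra \<Omega> M \<and> G \<subseteq> M}"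

end

theory Submission
  imports Defs "HOL-Number_Theory.Cong" "HOL-Combinatorics.Cycles"
begin

text \<open>If \<open>E\<close> is definable in both logics, then it is closed under conjugation, so membership only
  depends on the cycle type; by an Ehrenfeucht-Fraisse argument it does not change either when a
  monotone run of consecutive points and values with at least \<open>M\<close> elements is replaced by another such
  run. Placing an increasing run, the two increasing runs of a rotation, or a decreasing run after
  an arbitrary permutation and changing their lengths shows, as far as membership in \<open>E\<close> is
  concerned: the number of fixed points is irrelevant once it is at least \<open>M\<close>; a cycle longer than
  \<open>M\<close>, or \<open>M\<close> or more cycles of the same length \<open>d \<ge> 2\<close>, may be exchanged for \<open>M\<close> transpositions,
  which in turn absorb all other cycles (a \<open>d\<close>-cycle because \<open>M\<close> and \<open>M + 1\<close> cycles of length \<open>d\<close> are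
  interchangeable, a fixed point because decreasing runs of odd and of even length are). Hence \<open>E\<close> is
  trivial outside finitely many sets \<open>\<D> \<mu>\<close>, and on each \<open>\<D> \<mu>\<close> membership is eventually constant
  in the number of fixed points.\<close>

section \<open>Invariance of satisfaction\<close>

text \<open>The overview leaves open why the generators are definable. The obstacle lies in TOTO:
  \<open>\<sigma> i = j\<close> compares a value with a position, which the two orders cannot do. A
  permutation of \<open>{1..n}\<close> is however determined by the order of its values. So it is
  enough to list a set containing the moved points in increasing order and to prescribe how its
  members compare, by position and by value, with one another and with all other points;
  \<open>\<D> \<mu>\<close> is a finite union over such patterns. In TOOB the graph of
  \<open>\<sigma>\<close> is at hand, and in both logics \<open>\<C> \<mu>\<close> is cut out of
  \<open>\<D> \<mu>\<close> by a bound on the size. In the other direction the engine is arithmetic: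
  exchanging adjacent blocks of lengths \<open>a\<close> and \<open>b\<close> is addition of
  \<open>b\<close> modulo \<open>a + b\<close>, with \<open>gcd a b\<close> cycles of length
  \<open>(a + b) div gcd a b\<close>. A small change of long blocks is invisible to the orders but
  can change the cycle type completely. Transpositions are the common currency because they arise
  both from two equal blocks and from reversals. The threshold \<open>M\<close> is 2 to the
  quantifier rank of a defining TOTO sentence.\<close>

lemma holds_cong:
  assumes "\<And>x. x \<in> free_vars \<phi> \<Longrightarrow> v x = w x"
  shows "holds D I v \<phi> \<longleftrightarrow> holds D I w \<phi>"
  using assms
proof (induction \<phi> arbitrary: v w)
  case (Exists x \<phi>)
  have "holds D I (v(x := a)) \<phi> \<longleftrightarrow> holds D I (w(x := a)) \<phi>" for a
    by (rule Exists.IH) (use Exists.prems in auto)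
  then show ?case by simp
next
  case (Neg \<phi>)
  then show ?case by (metis free_vars.simps(3) holds.simps(3))
next
  case (Conj \<phi> \<psi>)
  have "holds D I v \<phi> \<longleftrightarrow> holds D I w \<phi>" "holds D I v \<psi> \<longleftrightarrow> holds D I w \<psi>"
    by (rule Conj.IH; use Conj.prems in auto)+
  then show ?case by simp
qed simp_all

lemma satisfies_sentence:
  assumes "sentence \<phi>"
  shows "satisfies D I \<phi> \<longleftrightarrow> holds D I v \<phi>"
  using assms holds_cong[of \<phi>] unfolding satisfies_def sentence_def by blast

lemma holds_iso:
  assumes bij: "bij_betw f D D'"
    and rel: "\<And>r x y. x \<in> D \<Longrightarrow> y \<in> D \<Longrightarrow> I r x y \<longleftrightarrow> I' r (f x) (f y)"
    and "v ` free_vars \<phi> \<subseteq> D"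
  shows "holds D I v \<phi> \<longleftrightarrow> holds D' I' (f \<circ> v) \<phi>"
  using assms(3)
proof (induction \<phi> arbitrary: v)
  case (Eq x y)
  then show ?case using bij by (auto simp: bij_betw_def inj_on_eq_iff)
next
  case (Rel r x y)
  then show ?case using rel by auto
next
  case (Exists x \<phi>)
  have IH: "holds D I (v(x := a)) \<phi> \<longleftrightarrow> holds D' I' ((f \<circ> v)(x := f a)) \<phi>" if "a \<in> D" for a
  proof -
    have "v(x := a) ` free_vars \<phi> \<subseteq> D" using Exists.prems that by auto
    moreover have "f \<circ> v(x := a) = (f \<circ> v)(x := f a)" by (auto simp: fun_eq_iff)
    ultimately show ?thesis using Exists.IH by metis
  qed
  have "D' = f ` D" using bij by (simp add: bij_betw_def)
  then show ?case using IH by (simp del: comp_apply fun_upd_apply add: o_def)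
next
  case (Neg \<phi>)
  then show ?case using Neg.IH[of v] by simp
next
  case (Conj \<phi> \<psi>)
  then show ?case using Conj.IH[of v] by (simp add: image_Un)
qed

lemma satisfies_iso:
  assumes "bij_betw f D D'" "sentence \<phi>"
    and "\<And>r x y. x \<in> D \<Longrightarrow> y \<in> D \<Longrightarrow> I r x y \<longleftrightarrow> I' r (f x) (f y)"
  shows "satisfies D I \<phi> \<longleftrightarrow> satisfies D' I' \<phi>"
proof -
  fix v :: "nat \<Rightarrow> 'a"
  have "v ` free_vars \<phi> \<subseteq> D" using assms(2) by (simp add: sentence_def)
  then have "holds D I v \<phi> \<longleftrightarrow> holds D' I' (f \<circ> v) \<phi>"
    by (rule holds_iso[OF assms(1), of I I', rotated]) (rule assms(3))
  then show ?thesis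
    using satisfies_sentence[OF assms(2), of D I v] satisfies_sentence[OF assms(2), of D' I' "f \<circ> v"] by simp
qed

text \<open>Moves the TOTO structure from the points \<open>(i, \<sigma> i)\<close> to the positions
  \<open>i\<close>, so that both logics share the domain \<open>{1..n}\<close>.\<close>

definition toto_pos_rel :: "(nat \<Rightarrow> nat) \<Rightarrow> toto_sym \<Rightarrow> nat \<Rightarrow> nat \<Rightarrow> bool" where
  "toto_pos_rel \<sigma> r i j \<longleftrightarrow> toto_rel r (i, \<sigma> i) (j, \<sigma> j)"

lemma toto_pos_rel_simps [simp]:
  "toto_pos_rel \<sigma> LessP i j \<longleftrightarrow> i < j"
  "toto_pos_rel \<sigma> LessV i j \<longleftrightarrow> \<sigma> i < \<sigma> j"
  by (simp_all add: toto_pos_rel_def)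

lemma satisfies_toto_dom:
  assumes "sentence \<phi>"
  shows "satisfies (toto_dom n \<sigma>) toto_rel \<phi> \<longleftrightarrow> satisfies {1..n} (toto_pos_rel \<sigma>) \<phi>"
  by (rule satisfies_iso[OF _ assms, symmetric, where f = "\<lambda>i. (i, \<sigma> i)"])
     (auto simp: toto_dom_def bij_betw_def inj_on_def toto_pos_rel_def)

section \<open>Expressible properties\<close>

text \<open>Formulas are never written out: closure properties of expressible predicates build them.
  One formula has to serve for all \<open>D\<close>, \<open>I\<close> and \<open>v\<close>, the
  empty domain included, and \<open>X\<close> bounds its free variables.\<close>

definition expressible :: "nat set \<Rightarrow> ('a set \<Rightarrow> ('r \<Rightarrow> 'a \<Rightarrow> 'a \<Rightarrow> bool) \<Rightarrow> (nat \<Rightarrow> 'a) \<Rightarrow> bool) \<Rightarrow> bool" where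
  "expressible X P \<longleftrightarrow> (\<exists>\<phi>. free_vars \<phi> \<subseteq> X \<and> (\<forall>D I v. holds D I v \<phi> \<longleftrightarrow> P D I v))"

lemma expressible_Eq: "x \<in> X \<Longrightarrow> y \<in> X \<Longrightarrow> expressible X (\<lambda>D I v. v x = v y)"
  unfolding expressible_def by (rule exI[of _ "Eq x y"]) auto

lemma expressible_Rel: "x \<in> X \<Longrightarrow> y \<in> X \<Longrightarrow> expressible X (\<lambda>D I v. I r (v x) (v y))"
  unfolding expressible_def by (rule exI[of _ "Rel r x y"]) auto

lemma expressible_not:
  assumes "expressible X P"
  shows "expressible X (\<lambda>D I v. \<not> P D I v)"
proof -
  from assms obtain \<phi> where "free_vars \<phi> \<subseteq> X" "\<forall>D I v. holds D I v \<phi> \<longleftrightarrow> P D I v"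
    unfolding expressible_def by blast
  then show ?thesis unfolding expressible_def by (intro exI[of _ "Neg \<phi>"]) auto
qed

lemma expressible_conj:
  assumes "expressible X P" "expressible X Q"
  shows "expressible X (\<lambda>D I v. P D I v \<and> Q D I v)"
proof -
  from assms obtain \<phi> \<psi> where "free_vars \<phi> \<subseteq> X" "\<forall>D I v. holds D I v \<phi> \<longleftrightarrow> P D I v"
    "free_vars \<psi> \<subseteq> X" "\<forall>D I v. holds D I v \<psi> \<longleftrightarrow> Q D I v" unfolding expressible_def by blast
  then show ?thesis unfolding expressible_def by (intro exI[of _ "Conj \<phi> \<psi>"]) auto
qed

lemma expressible_ex:
  assumes "expressible (insert x X) P"
  shows "expressible X (\<lambda>D I v. \<exists>a\<in>D. P D I (v(x := a)))"
proof -
  from assms obtain \<phi> where "free_vars \<phi> \<subseteq> insert x X" "\<forall>D I v. holds D I v \<phi> \<longleftrightarrow> P D I v"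
    unfolding expressible_def by blast
  then show ?thesis unfolding expressible_def by (intro exI[of _ "Exists x \<phi>"]) auto
qed

lemma expressible_imp:
  assumes "expressible X P" "expressible X Q"
  shows "expressible X (\<lambda>D I v. P D I v \<longrightarrow> Q D I v)"
  using expressible_not[OF expressible_conj[OF assms(1) expressible_not[OF assms(2)]]] by simp

lemma expressible_iff:
  assumes "expressible X P" "expressible X Q"
  shows "expressible X (\<lambda>D I v. P D I v \<longleftrightarrow> Q D I v)"
proof -
  have "(\<lambda>D I v. P D I v \<longleftrightarrow> Q D I v) = (\<lambda>D I v. (P D I v \<longrightarrow> Q D I v) \<and> (Q D I v \<longrightarrow> P D I v))"
    by (intro ext) blast
  then show ?thesis using expressible_conj[OF expressible_imp[OF assms] expressible_imp[OF assms(2,1)]]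
    by simp
qed

lemma expressible_all:
  assumes "expressible (insert x X) P"
  shows "expressible X (\<lambda>D I v. \<forall>a\<in>D. P D I (v(x := a)))"
  using expressible_not[OF expressible_ex[OF expressible_not[OF assms]]] by simp

text \<open>The syntax has no truth constant; the negation of "some element differs from itself"
  replaces it, over the empty domain as well.\<close>

lemma expressible_True: "expressible X (\<lambda>D I v. True)"
  using expressible_not[OF expressible_ex[OF expressible_not[OF expressible_Eq[of 0 "insert 0 X" 0]]]]
  by simp

lemma expressible_ball:
  assumes "finite A" "\<And>i. i \<in> A \<Longrightarrow> expressible X (P i)"
  shows "expressible X (\<lambda>D I v. \<forall>i\<in>A. P i D I v)"
  using assms
proof (induction A)
  case empty
  then show ?case using expressible_True by simp
next
  case (insert j A)
  then show ?case using expressible_conj[of X "P j"] by simp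
qed

text \<open>\<open>b\<close> stands for a condition on indices of variables, such as
  \<open>i < j\<close>; it is decided while the formula is built and leaves no trace in it.\<close>

lemma expressible_const_imp:
  assumes "b \<Longrightarrow> expressible X P"
  shows "expressible X (\<lambda>D I v. b \<longrightarrow> P D I v)"
  using assms expressible_True by (cases b) auto

text \<open>The variables from 1 to \<open>k\<close> are reserved for a tuple \<open>p\<close> bound
  by a block of \<open>k\<close> quantifiers; the induction adds \<open>Suc k\<close> as the
  innermost one.\<close>

lemma expressible_exs:
  assumes "expressible ({1..k} \<union> X) P"
  shows "expressible X (\<lambda>D I v. \<exists>p\<in>{1..k} \<rightarrow> D. P D I (\<lambda>x. if x \<in> {1..k} then p x else v x))"
  using assms
proof (induction k arbitrary: P)
  case 0
  then show ?case by simp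
next
  case (Suc k)
  have "{1..Suc k} \<union> X = insert (Suc k) ({1..k} \<union> X)" by auto
  with Suc.prems have "expressible ({1..k} \<union> X) (\<lambda>D I v. \<exists>a\<in>D. P D I (v(Suc k := a)))"
    by (intro expressible_ex) simp
  from Suc.IH[OF this] have *: "expressible X (\<lambda>D I v. \<exists>p\<in>{1..k} \<rightarrow> D. \<exists>a\<in>D.
      P D I ((\<lambda>x. if x \<in> {1..k} then p x else v x)(Suc k := a)))" .
  have "(\<exists>p\<in>{1..k} \<rightarrow> D. \<exists>a\<in>D. P D I ((\<lambda>x. if x \<in> {1..k} then p x else v x)(Suc k := a))) \<longleftrightarrow>
      (\<exists>p\<in>{1..Suc k} \<rightarrow> D. P D I (\<lambda>x. if x \<in> {1..Suc k} then p x else v x))" (is "?L \<longleftrightarrow> ?R") for D I v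
  proof
    assume ?L
    then obtain p a where p: "p \<in> {1..k} \<rightarrow> D" "a \<in> D"
      "P D I ((\<lambda>x. if x \<in> {1..k} then p x else v x)(Suc k := a))" by blast
    have "(\<lambda>x. if x \<in> {1..k} then p x else v x)(Suc k := a) =
      (\<lambda>x. if x \<in> {1..Suc k} then (p(Suc k := a)) x else v x)" by (auto simp: fun_eq_iff)
    with p(3) have "P D I (\<lambda>x. if x \<in> {1..Suc k} then (p(Suc k := a)) x else v x)" by simp
    moreover have "p(Suc k := a) \<in> {1..Suc k} \<rightarrow> D" using p(1,2) by (auto simp: le_Suc_eq)
    ultimately show ?R by blast
  next
    assume ?R
    then obtain p where p: "p \<in> {1..Suc k} \<rightarrow> D"
      "P D I (\<lambda>x. if x \<in> {1..Suc k} then p x else v x)" by blast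
    have "(\<lambda>x. if x \<in> {1..Suc k} then p x else v x) =
      (\<lambda>x. if x \<in> {1..k} then p x else v x)(Suc k := p (Suc k))" by (auto simp: fun_eq_iff)
    with p show ?L by (intro bexI[of _ p] bexI[of _ "p (Suc k)"]) auto
  qed
  with * show ?case by simp
qed

lemma expressible_sentence:
  assumes "expressible {} P"
  shows "\<exists>\<phi>. sentence \<phi> \<and> (\<forall>D I v. satisfies D I \<phi> \<longleftrightarrow> P D I v)"
proof -
  from assms obtain \<phi> where "sentence \<phi>" "\<And>D I v. holds D I v \<phi> \<longleftrightarrow> P D I v"
    unfolding expressible_def sentence_def by blast
  then have "satisfies D I \<phi> \<longleftrightarrow> P D I v" for D I v using satisfies_sentence by metis
  then show ?thesis using \<open>sentence \<phi>\<close> by blast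
qed

section \<open>Ehrenfeucht-Fraisse games on monotone runs\<close>

primrec quantifier_rank :: "'r fo \<Rightarrow> nat" where
  "quantifier_rank (Eq x y) = 0"
| "quantifier_rank (Rel r x y) = 0"
| "quantifier_rank (Neg \<phi>) = quantifier_rank \<phi>"
| "quantifier_rank (Conj \<phi> \<psi>) = max (quantifier_rank \<phi>) (quantifier_rank \<psi>)"
| "quantifier_rank (Exists x \<phi>) = Suc (quantifier_rank \<phi>)"

text \<open>Signed distances that \<open>k\<close> further rounds cannot tell apart. A move may
  split a gap into two halves, so the threshold doubles with each round.\<close>

definition dist_equiv :: "nat \<Rightarrow> int \<Rightarrow> int \<Rightarrow> bool" where
  "dist_equiv k d e \<longleftrightarrow> d = e \<or> (2 ^ k \<le> d \<and> 2 ^ k \<le> e) \<or> (d \<le> - (2 ^ k) \<and> e \<le> - (2 ^ k))"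

definition dist_matching :: "nat \<Rightarrow> (int \<times> int) set \<Rightarrow> bool" where
  "dist_matching k S \<longleftrightarrow> (\<forall>(p, p')\<in>S. \<forall>(q, q')\<in>S. dist_equiv k (p - q) (p' - q'))"

lemma dist_equiv_sgn:
  assumes "dist_equiv k d e"
  shows "d < 0 \<longleftrightarrow> e < 0" "d = 0 \<longleftrightarrow> e = 0"
proof -
  have "(0::int) < 2 ^ k" by simp
  then show "d < 0 \<longleftrightarrow> e < 0" "d = 0 \<longleftrightarrow> e = 0" using assms unfolding dist_equiv_def by linarith+
qed

lemma dist_equiv_sym: "dist_equiv k d e \<Longrightarrow> dist_equiv k e d"
  unfolding dist_equiv_def by auto

lemma dist_equiv_uminus: "dist_equiv k d e \<Longrightarrow> dist_equiv k (- d) (- e)"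
  unfolding dist_equiv_def by auto

lemma dist_equiv_swap: "dist_equiv k (a - b) (c - d) \<Longrightarrow> dist_equiv k (b - a) (d - c)"
  using dist_equiv_uminus by fastforce

lemma dist_equiv_mono:
  assumes "dist_equiv (Suc k) d e"
  shows "dist_equiv k d e"
proof -
  have "(0::int) < 2 ^ k" by simp
  then show ?thesis using assms unfolding dist_equiv_def power_Suc by linarith
qed

lemma dist_matching_mono: "dist_matching (Suc k) S \<Longrightarrow> dist_matching k S"
  using dist_equiv_mono unfolding dist_matching_def by fastforce

lemma dist_matching_subset: "dist_matching k S \<Longrightarrow> T \<subseteq> S \<Longrightarrow> dist_matching k T"
  unfolding dist_matching_def by blast

lemma dist_matching_converse: "dist_matching k S \<Longrightarrow> dist_matching k (S\<inverse>)"
  using dist_equiv_sym unfolding dist_matching_def by fastforce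

lemma dist_matching_insert:
  assumes "dist_matching k S" "\<And>q q'. (q, q') \<in> S \<Longrightarrow> dist_equiv k (p - q) (p' - q')"
  shows "dist_matching k (insert (p, p') S)"
proof -
  have "dist_equiv k 0 0" by (simp add: dist_equiv_def)
  moreover have "dist_equiv k (q - p) (q' - p')" if "(q, q') \<in> S" for q q'
    by (rule dist_equiv_swap) (rule assms(2)[OF that])
  ultimately show ?thesis using assms unfolding dist_matching_def by auto
qed

text \<open>One round of the game on a linear order. The pairs \<open>(l, l')\<close> and
  \<open>(u, u')\<close> guarantee matched neighbours on both sides of \<open>p\<close>. If
  \<open>p\<close> is close to a matched point, the answer copies the offset; otherwise it goes one
  full threshold above the partner of the nearest matched point below.\<close>

lemma dist_matching_extend:
  assumes S: "finite S" "dist_matching (Suc k) S" "(l, l') \<in> S" "(u, u') \<in> S" and p: "l < p" "p < u"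
  obtains p' where "l' < p'" "p' < u'" "dist_matching k (insert (p, p') S)"
proof -
  have pos: "(0::int) < 2 ^ k" by simp
  have m: "dist_equiv (Suc k) (q - r) (q' - r')" if "(q, q') \<in> S" "(r, r') \<in> S" for q q' r r'
    using S(2) that unfolding dist_matching_def by blast
  have "\<exists>p'. \<forall>q q'. (q, q') \<in> S \<longrightarrow> dist_equiv k (p - q) (p' - q')"
  proof (cases "\<exists>(q, q')\<in>S. \<bar>p - q\<bar> < 2 ^ k")
    case True
    then obtain q q' where q: "(q, q') \<in> S" "\<bar>p - q\<bar> < 2 ^ k" by auto
    \<comment> \<open>Distances from \<open>q\<close> agree or are at least \<open>2 ^ Suc k\<close>
      on both sides; an offset below \<open>2 ^ k\<close> leaves at least \<open>2 ^ k\<close> of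
      the latter.\<close>
    have "dist_equiv k (p - r) (q' + (p - q) - r')" if "(r, r') \<in> S" for r r'
      using m[OF q(1) that] q(2) pos unfolding dist_equiv_def power_Suc by linarith
    then show ?thesis by blast
  next
    case False
    then have far: "2 ^ k \<le> \<bar>p - q\<bar>" if "(q, q') \<in> S" for q q' using that by fastforce
    let ?B = "{q \<in> fst ` S. q \<le> p}" and ?A = "{q \<in> fst ` S. p \<le> q}"
    have fin: "finite ?B" "finite ?A" using S(1) by simp_all
    have "l \<in> fst ` S" "u \<in> fst ` S" using imageI[OF S(3), of fst] imageI[OF S(4), of fst] by simp_all
    then have ne: "?B \<noteq> {}" "?A \<noteq> {}" using p less_imp_le by blast+
    define q r where "q = Max ?B" and "r = Min ?A"
    have "q \<in> ?B" "r \<in> ?A" unfolding q_def r_def by (rule Max_in Min_in; fact fin ne)+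
    then have q: "q \<in> fst ` S" "q \<le> p" and r: "r \<in> fst ` S" "p \<le> r" by simp_all
    have q_max: "t \<le> q" if "(t, t') \<in> S" "t \<le> p" for t t'
      unfolding q_def by (rule Max_ge[OF fin(1)]) (use that imageI[OF that(1), of fst] in simp)
    have r_min: "r \<le> t" if "(t, t') \<in> S" "p \<le> t" for t t'
      unfolding r_def by (rule Min_le[OF fin(2)]) (use that imageI[OF that(1), of fst] in simp)
    obtain q' r' where q': "(q, q') \<in> S" and r': "(r, r') \<in> S" using q(1) r(1) by auto
    \<comment> \<open>\<open>p\<close> is at least \<open>2 ^ k\<close> away from both neighbours,
      so the gap around it has twice that length, and so has the matched gap. Hence
      \<open>q' + 2 ^ k\<close> keeps the same distance from \<open>r'\<close>.\<close>
    have gap: "2 ^ Suc k \<le> r' - q'"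
      using m[OF r' q'] far[OF q'] far[OF r'] pos q(2) r(2) unfolding dist_equiv_def power_Suc by linarith
    have "dist_equiv k (p - t) (q' + 2 ^ k - t')" if t: "(t, t') \<in> S" for t t'
    proof (cases "t \<le> p")
      case True
      then have "t \<le> q" using q_max[OF t] by blast
      then have "t' \<le> q'" using m[OF t q'] pos unfolding dist_equiv_def power_Suc by linarith
      then show ?thesis using far[OF t] True unfolding dist_equiv_def by linarith
    next
      case False
      then have "r \<le> t" using r_min[OF t] by simp
      then have "r' \<le> t'" using m[OF t r'] pos unfolding dist_equiv_def power_Suc by linarith
      then show ?thesis using far[OF t] False gap unfolding dist_equiv_def power_Suc by linarith
    qed
    then show ?thesis by blast
  qed
  then obtain p' where p': "\<And>q q'. (q, q') \<in> S \<Longrightarrow> dist_equiv k (p - q) (p' - q')" by blast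
  have "l' < p'" "p' < u'"
    using dist_equiv_sgn[OF p'[OF S(3)]] dist_equiv_sgn[OF p'[OF S(4)]] p by linarith+
  then show ?thesis using that dist_matching_insert[OF dist_matching_mono[OF S(2)] p'] by blast
qed

definition run_dom :: "('c \<Rightarrow> nat) \<Rightarrow> ('c \<times> int) set" where
  "run_dom a = {(c, i). 0 \<le> i \<and> i < int (a c)}"

text \<open>Points of different runs are compared through their runs by \<open>T\<close>, whatever
  the lengths; within a run, \<open>s\<close> says whether \<open>r\<close> follows the index or
  goes against it. Stretching a run thus affects only comparisons inside it.\<close>

definition run_rel :: "('r \<Rightarrow> 'c \<Rightarrow> 'c \<Rightarrow> bool) \<Rightarrow> ('r \<Rightarrow> 'c \<Rightarrow> bool) \<Rightarrow> 'r \<Rightarrow> 'c \<times> int \<Rightarrow> 'c \<times> int \<Rightarrow> bool" where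
  "run_rel T s r x y \<longleftrightarrow>
     (if fst x = fst y then (if s r (fst x) then snd x < snd y else snd y < snd x)
      else T r (fst x) (fst y))"

text \<open>The sentinels \<open>-1\<close> and \<open>a c\<close> make the distances to the ends of the run part of the invariant.\<close>

definition run_matching ::
  "('c \<Rightarrow> nat) \<Rightarrow> ('c \<Rightarrow> nat) \<Rightarrow> nat set \<Rightarrow> (nat \<Rightarrow> 'c \<times> int) \<Rightarrow> (nat \<Rightarrow> 'c \<times> int) \<Rightarrow> 'c \<Rightarrow> (int \<times> int) set" where
  "run_matching a b X v w c =
     {(-1, -1), (int (a c), int (b c))} \<union> (\<lambda>x. (snd (v x), snd (w x))) ` {x \<in> X. fst (v x) = c}"

definition run_equiv ::
  "nat \<Rightarrow> ('c \<Rightarrow> nat) \<Rightarrow> ('c \<Rightarrow> nat) \<Rightarrow> nat set \<Rightarrow> (nat \<Rightarrow> 'c \<times> int) \<Rightarrow> (nat \<Rightarrow> 'c \<times> int) \<Rightarrow> bool" where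
  "run_equiv k a b X v w \<longleftrightarrow>
     (\<forall>x\<in>X. fst (v x) = fst (w x)) \<and> (\<forall>c. dist_matching k (run_matching a b X v w c))"

lemma run_equiv_sym: "run_equiv k a b X v w \<Longrightarrow> run_equiv k b a X w v"
proof -
  assume *: "run_equiv k a b X v w"
  then have "run_matching b a X w v c = (run_matching a b X v w c)\<inverse>" for c
    unfolding run_equiv_def run_matching_def by (auto simp: image_iff)
  then show ?thesis using * dist_matching_converse unfolding run_equiv_def by fastforce
qed

text \<open>The answer is played in the same run, so each run is a separate game on one linear
  order.\<close>

lemma run_equiv_extend:
  assumes eq: "run_equiv (Suc k) a b X v w" and "finite X" and p: "p \<in> run_dom a"
  obtains q where "q \<in> run_dom b" "run_equiv k a b (insert x X) (v(x := p)) (w(x := q))"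
proof -
  obtain c i where [simp]: "p = (c, i)" by (cases p)
  let ?S = "run_matching a b X v w"
  have i: "-1 < i" "i < int (a c)" using p by (auto simp: run_dom_def)
  have "finite (?S c)" "dist_matching (Suc k) (?S c)" "(-1, -1) \<in> ?S c" "(int (a c), int (b c)) \<in> ?S c"
    using eq \<open>finite X\<close> by (auto simp: run_equiv_def run_matching_def)
  from dist_matching_extend[OF this i] obtain j where
    j: "-1 < j" "j < int (b c)" "dist_matching k (insert (i, j) (?S c))" by blast
  have "dist_matching k (run_matching a b (insert x X) (v(x := p)) (w(x := (c, j))) d)" for d
  proof (cases "d = c")
    case True
    \<comment> \<open>If \<open>x\<close> already had a value, its old pair may disappear; in
      general only an inclusion of matchings is available.\<close>
    show ?thesis by (rule dist_matching_subset[OF j(3)]) (auto simp: run_matching_def True)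
  next
    case False
    have "dist_matching k (?S d)" using eq dist_matching_mono by (auto simp: run_equiv_def)
    then show ?thesis by (rule dist_matching_subset) (use False in \<open>auto simp: run_matching_def\<close>)
  qed
  then have "run_equiv k a b (insert x X) (v(x := p)) (w(x := (c, j)))"
    using eq by (auto simp: run_equiv_def)
  moreover have "(c, j) \<in> run_dom b" using j by (auto simp: run_dom_def)
  ultimately show ?thesis using that by blast
qed

lemma run_equiv_compare:
  assumes "run_equiv k a b X v w" "x \<in> X" "y \<in> X" "fst (v x) = fst (v y)"
  shows "snd (v x) < snd (v y) \<longleftrightarrow> snd (w x) < snd (w y)" "snd (v x) = snd (v y) \<longleftrightarrow> snd (w x) = snd (w y)"
proof -
  have "dist_equiv k (snd (v x) - snd (v y)) (snd (w x) - snd (w y))"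
    using assms unfolding run_equiv_def dist_matching_def run_matching_def by fastforce
  from dist_equiv_sgn[OF this] show "snd (v x) < snd (v y) \<longleftrightarrow> snd (w x) < snd (w y)"
    "snd (v x) = snd (v y) \<longleftrightarrow> snd (w x) = snd (w y)" by simp_all
qed

text \<open>\<open>k\<close> bounds the rounds left. Quantifiers are answered from either side;
  atoms agree because equivalent distances have the same sign and different runs are compared
  through \<open>T\<close> alone.\<close>

lemma holds_run_equiv:
  assumes "quantifier_rank \<phi> \<le> k" "free_vars \<phi> \<subseteq> X" "finite X" "run_equiv k a b X v w"
  shows "holds (run_dom a) (run_rel T s) v \<phi> \<longleftrightarrow> holds (run_dom b) (run_rel T s) w \<phi>"
  using assms
proof (induction \<phi> arbitrary: k X v w)
  case (Eq x y)
  then have "fst (v x) = fst (w x)" "fst (v y) = fst (w y)" by (auto simp: run_equiv_def)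
  then show ?case using run_equiv_compare(2)[OF Eq.prems(4), of x y] Eq.prems(2) by (auto simp: prod_eq_iff)
next
  case (Rel r x y)
  then have *: "fst (w x) = fst (v x)" "fst (w y) = fst (v y)" by (auto simp: run_equiv_def)
  then show ?case
    using run_equiv_compare(1)[OF Rel.prems(4), of x y] run_equiv_compare(1)[OF Rel.prems(4), of y x] Rel.prems(2)
    by (auto simp: run_rel_def *)
next
  case (Exists x \<phi>)
  then obtain m where m: "k = Suc m" "quantifier_rank \<phi> \<le> m" by (cases k) auto
  have sub: "free_vars \<phi> \<subseteq> insert x X" "finite (insert x X)" using Exists.prems by auto
  have eq: "run_equiv (Suc m) a b X v w" using Exists.prems m by simp
  show ?case
  proof
    assume "holds (run_dom a) (run_rel T s) v (Exists x \<phi>)"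
    then obtain p where p: "p \<in> run_dom a" "holds (run_dom a) (run_rel T s) (v(x := p)) \<phi>" by auto
    from run_equiv_extend[OF eq \<open>finite X\<close> p(1)] obtain q where
      "q \<in> run_dom b" "run_equiv m a b (insert x X) (v(x := p)) (w(x := q))" by blast
    then show "holds (run_dom b) (run_rel T s) w (Exists x \<phi>)"
      using Exists.IH[OF m(2) sub] p(2) by auto
  next
    assume "holds (run_dom b) (run_rel T s) w (Exists x \<phi>)"
    then obtain q where q: "q \<in> run_dom b" "holds (run_dom b) (run_rel T s) (w(x := q)) \<phi>" by auto
    from run_equiv_extend[OF run_equiv_sym[OF eq] \<open>finite X\<close> q(1)] obtain p where
      "p \<in> run_dom a" "run_equiv m b a (insert x X) (w(x := q)) (v(x := p))" by blast
    then show "holds (run_dom a) (run_rel T s) v (Exists x \<phi>)"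
      using Exists.IH[OF m(2) sub run_equiv_sym] q(2) by auto
  qed
next
  case (Conj \<phi> \<psi>)
  then show ?case by (metis (no_types, lifting) Un_subset_iff free_vars.simps(4) holds.simps(4)
    max.bounded_iff quantifier_rank.simps(4))
next
  case (Neg \<phi>)
  then show ?case by (metis free_vars.simps(3) holds.simps(3) quantifier_rank.simps(3))
qed

lemma satisfies_run_equiv:
  assumes "sentence \<phi>" "quantifier_rank \<phi> \<le> k" "\<And>c. a c = b c \<or> (2 ^ k \<le> a c \<and> 2 ^ k \<le> b c)"
  shows "satisfies (run_dom a) (run_rel T s) \<phi> \<longleftrightarrow> satisfies (run_dom b) (run_rel T s) \<phi>"
proof -
  have le: "2 ^ k \<le> n \<Longrightarrow> 2 ^ k \<le> int n" for n by (metis of_nat_le_iff of_nat_numeral of_nat_power)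
  \<comment> \<open>Before the first move only the sentinels are matched, and they are
    \<open>a c + 1\<close> apart; a bound of \<open>2 ^ k\<close> on the lengths therefore
    suffices.\<close>
  have "dist_equiv k (int (a c) + 1) (int (b c) + 1)" for c
    using assms(3)[of c] le[of "a c"] le[of "b c"] unfolding dist_equiv_def by linarith
  moreover from this have "dist_equiv k (- 1 - int (a c)) (- 1 - int (b c))" for c
    using dist_equiv_uminus[of k "int (a c) + 1" "int (b c) + 1"] by (simp add: algebra_simps)
  ultimately have "run_equiv k a b {} v v" for v
    by (auto simp: run_equiv_def run_matching_def dist_matching_def) (auto simp: dist_equiv_def)
  then have "holds (run_dom a) (run_rel T s) v \<phi> \<longleftrightarrow> holds (run_dom b) (run_rel T s) v \<phi>" for v
    using holds_run_equiv[OF assms(2), of "{}" a b v v] assms(1) by (simp add: sentence_def)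
  then show ?thesis by (simp add: satisfies_def)
qed

section \<open>Cycle types\<close>

definition cycle_type_on :: "'a set \<Rightarrow> ('a \<Rightarrow> 'a) \<Rightarrow> nat multiset" where
  "cycle_type_on A \<sigma> = image_mset card (mset_set (orbit \<sigma> ` A))"

lemma cycle_type_eq: "cycle_type n \<sigma> = cycle_type_on {1..n} \<sigma>"
  by (simp add: cycle_type_def cycle_type_on_def)

lemma orbit_subset_invariant:
  assumes "\<sigma> ` A \<subseteq> A" "x \<in> A"
  shows "orbit \<sigma> x \<subseteq> A"
proof
  fix y assume "y \<in> orbit \<sigma> x"
  then show "y \<in> A" by induction (use assms in auto)
qed

lemma orbit_image:
  assumes "\<sigma> ` A \<subseteq> A" "x \<in> A" "\<And>y. y \<in> A \<Longrightarrow> f (\<sigma> y) = \<sigma>' (f y)"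
  shows "orbit \<sigma>' (f x) = f ` orbit \<sigma> x"
proof -
  have "(\<sigma> ^^ n) x \<in> A \<and> (\<sigma>' ^^ n) (f x) = f ((\<sigma> ^^ n) x)" for n
    by (induction n) (use assms in auto)
  then show ?thesis unfolding orbit_altdef by (auto simp: image_iff)
qed

text \<open>\<open>f\<close> has to intertwine the two maps only on the invariant set
  \<open>A\<close>. This covers relabelling and, with the identity for \<open>f\<close>, the passage
  between maps that agree on \<open>A\<close>.\<close>

lemma cycle_type_on_image:
  assumes "finite A" "\<sigma> ` A \<subseteq> A" "inj_on f A" "\<And>y. y \<in> A \<Longrightarrow> f (\<sigma> y) = \<sigma>' (f y)"
  shows "cycle_type_on (f ` A) \<sigma>' = cycle_type_on A \<sigma>"
proof -
  have sub: "orbit \<sigma> x \<subseteq> A" if "x \<in> A" for x by (rule orbit_subset_invariant) fact+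
  have "orbit \<sigma>' (f x) = f ` orbit \<sigma> x" if "x \<in> A" for x
    using orbit_image[of \<sigma> A x f \<sigma>'] assms that by blast
  then have *: "orbit \<sigma>' ` f ` A = image f ` (orbit \<sigma> ` A)" by (simp add: image_image)
  have inj: "inj_on (image f) (orbit \<sigma> ` A)"
    by (rule inj_on_subset[OF inj_on_image_Pow[OF assms(3)]]) (use sub in blast)
  have "cycle_type_on (f ` A) \<sigma>' = image_mset card (image_mset (image f) (mset_set (orbit \<sigma> ` A)))"
    by (simp add: cycle_type_on_def * image_mset_mset_set[OF inj])
  also have "\<dots> = cycle_type_on A \<sigma>"
    unfolding cycle_type_on_def multiset.map_comp
    by (rule image_mset_cong) (use assms(1) sub in \<open>auto intro!: card_image inj_on_subset[OF assms(3)]\<close>)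
  finally show ?thesis .
qed

lemma cycle_type_on_cong:
  assumes "finite A" "\<sigma> ` A \<subseteq> A" "\<And>y. y \<in> A \<Longrightarrow> \<sigma> y = \<sigma>' y"
  shows "cycle_type_on A \<sigma> = cycle_type_on A \<sigma>'"
  using cycle_type_on_image[OF assms(1,2), of "\<lambda>x. x" \<sigma>'] assms(3) by simp

text \<open>An orbit that starts in an invariant set stays there, so no orbit is counted for both
  \<open>A\<close> and \<open>B\<close>.\<close>

lemma cycle_type_on_Un:
  assumes "finite A" "finite B" "A \<inter> B = {}" "\<sigma> ` A \<subseteq> A" "\<sigma> ` B \<subseteq> B"
  shows "cycle_type_on (A \<union> B) \<sigma> = cycle_type_on A \<sigma> + cycle_type_on B \<sigma>"
proof -
  have "orbit \<sigma> ` A \<inter> orbit \<sigma> ` B = {}"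
  proof -
    have "orbit \<sigma> x \<noteq> orbit \<sigma> y" if "x \<in> A" "y \<in> B" for x y
      using orbit_subset_invariant[OF assms(4) that(1)] orbit_subset_invariant[OF assms(5) that(2)]
        orbit_nonempty[of \<sigma> x] assms(3) by blast
    then show ?thesis by blast
  qed
  then show ?thesis using assms(1,2)
    by (simp add: cycle_type_on_def image_Un mset_set_Union)
qed

lemma cycle_type_on_cyclic:
  assumes "A \<noteq> {}" "\<And>x. x \<in> A \<Longrightarrow> orbit \<sigma> x = A"
  shows "cycle_type_on A \<sigma> = {#card A#}"
proof -
  have "orbit \<sigma> ` A = {A}" using assms by auto
  then show ?thesis by (simp add: cycle_type_on_def)
qed

lemma cycle_type_on_id:
  assumes "finite A" "\<And>x. x \<in> A \<Longrightarrow> \<sigma> x = x"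
  shows "cycle_type_on A \<sigma> = replicate_mset (card A) 1"
proof -
  have *: "orbit \<sigma> x = {x}" if "x \<in> A" for x using assms(2)[OF that] by (simp add: orbit_eq_singleton_iff)
  have inj: "inj_on (orbit \<sigma>) A" using * by (auto simp: inj_on_def)
  have "cycle_type_on A \<sigma> = image_mset card (image_mset (orbit \<sigma>) (mset_set A))"
    by (simp add: cycle_type_on_def image_mset_mset_set[OF inj])
  also have "\<dots> = image_mset (\<lambda>_. 1) (mset_set A)"
    unfolding multiset.map_comp by (rule image_mset_cong) (use * assms(1) in simp)
  finally show ?thesis by (simp add: image_mset_const_eq)
qed

lemma integer_partition_cycle_type:
  assumes "\<sigma> permutes {1..n}"
  shows "integer_partition (cycle_type n \<sigma>)"
proof -
  have "finite (orbit \<sigma> x)" if "x \<in> {1..n}" for x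
    by (rule finite_subset[OF permutes_orbit_subset[OF assms that]]) simp
  then show ?thesis unfolding integer_partition_def cycle_type_def
    using orbit_nonempty[of \<sigma>] by auto
qed

section \<open>Conjugacy of permutations with equal cycle types\<close>

lemma image_mset_eq_obtain_bij:
  assumes "finite X" "finite Y" "image_mset f (mset_set X) = image_mset g (mset_set Y)"
  obtains h where "bij_betw h X Y" "\<And>x. x \<in> X \<Longrightarrow> g (h x) = f x"
proof -
  have "\<exists>h. bij_betw h X Y \<and> (\<forall>x\<in>X. g (h x) = f x)"
    using assms
  proof (induction X arbitrary: Y)
    case empty
    then have "mset_set Y = {#}" by auto
    then have "Y = {}" using empty.prems(1) by (simp add: mset_set_empty_iff)
    then show ?case by (simp add: bij_betw_def)
  next
    case (insert x X)
    then have eq: "image_mset g (mset_set Y) = add_mset (f x) (image_mset f (mset_set X))" by simp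
    then have "f x \<in># image_mset g (mset_set Y)" by simp
    then obtain y where y: "y \<in> Y" "g y = f x" using insert.prems(1) by auto
    then have "mset_set Y = add_mset y (mset_set (Y - {y}))"
      using insert.prems(1) by (simp add: mset_set.remove)
    then have "image_mset f (mset_set X) = image_mset g (mset_set (Y - {y}))" using eq y by simp
    from insert.IH[OF _ this] insert.prems(1) obtain h where
      h: "bij_betw h X (Y - {y})" "\<forall>x\<in>X. g (h x) = f x" by auto
    have "bij_betw (h(x := y)) (insert x X) Y"
    proof -
      have "bij_betw (h(x := y)) X (Y - {y})"
        using h(1) insert.hyps(2) by (subst bij_betw_cong[of _ _ h]) auto
      from notIn_Un_bij_betw[OF _ _ this, of x] show ?thesis
        using insert.hyps(2) y(1) by (simp add: insert_absorb)
    qed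
    moreover have "\<forall>z\<in>insert x X. g ((h(x := y)) z) = f z" using h(2) y(2) insert.hyps(2) by auto
    ultimately show ?case by blast
  qed
  then show ?thesis using that by blast
qed

lemma orbit_eq_if_mem:
  assumes "permutation p" "y \<in> orbit p x"
  shows "orbit p y = orbit p x"
  by (rule orbit_cyclic_eq3[OF cyclic_on_orbit'[OF assms(1)] assms(2)])

text \<open>The first return to \<open>a\<close> happens after as many steps as its orbit has
  points, so exponents matter only modulo that number. The list \<open>support\<close> links the
  orbit to \<open>least_power\<close>.\<close>

lemma funpow_eq_iff_cong:
  assumes "permutation p"
  shows "(p ^^ i) a = (p ^^ j) a \<longleftrightarrow> [i = j] (mod card (orbit p a))"
proof -
  have "set (support p a) = orbit p a"
    using support_set[OF assms] orbit_altdef_permutation[OF assms, of a] by auto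
  moreover have "distinct (support p a)" using cycle_of_permutation[OF assms] by simp
  ultimately have card: "card (orbit p a) = least_power p a" using distinct_card by fastforce
  have inj: "inj (p ^^ n)" for n
    using assms by (simp add: bij_is_inj permutation_bijective permutation_funpow)
  have *: "(p ^^ i) a = (p ^^ j) a \<longleftrightarrow> [i = j] (mod card (orbit p a))" if "i \<le> j" for i j
  proof -
    have "(p ^^ j) a = (p ^^ i) ((p ^^ (j - i)) a)"
      using that by (metis comp_apply funpow_add le_add_diff_inverse)
    then have "(p ^^ i) a = (p ^^ j) a \<longleftrightarrow> (p ^^ (j - i)) a = a"
      using inj[of i] by (metis injD)
    also have "\<dots> \<longleftrightarrow> [j = i] (mod card (orbit p a))"
      using least_power_dvd[OF assms] that by (simp add: card cong_altdef_nat)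
    finally show ?thesis by (simp add: cong_sym_eq)
  qed
  show ?thesis using *[of i j] *[of j i] by (metis cong_sym_eq nat_le_linear)
qed

text \<open>Orbits are paired off by size, a base point is chosen in each, and \<open>f\<close>
  sends every iterate of a base point to the iterate of its partner with the same exponent.\<close>

theorem conjugate_if_cycle_type_on_eq:
  assumes fin: "finite A" "finite B" and perm: "\<sigma> permutes A" "\<tau> permutes B"
    and eq: "cycle_type_on A \<sigma> = cycle_type_on B \<tau>"
  obtains f where "bij_betw f A B" "\<And>x. x \<in> A \<Longrightarrow> f (\<sigma> x) = \<tau> (f x)"
proof -
  have p: "permutation \<sigma>" "permutation \<tau>" using fin perm by (auto intro: permutes_imp_permutation)
  obtain h where h: "bij_betw h (orbit \<sigma> ` A) (orbit \<tau> ` B)"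
    "\<And>C. C \<in> orbit \<sigma> ` A \<Longrightarrow> card (h C) = card C"
    by (rule image_mset_eq_obtain_bij[of "orbit \<sigma> ` A" "orbit \<tau> ` B" card card])
       (use fin eq in \<open>auto simp: cycle_type_on_def\<close>)
  \<comment> \<open>Choosing from the orbit as a set, and not starting from one of its points, gives
    all points of an orbit the same base point.\<close>
  define base where "base = (\<lambda>C :: 'a set. SOME x. x \<in> C)"
  define base' where "base' = (\<lambda>C :: 'b set. SOME x. x \<in> C)"
  define b where "b x = base (orbit \<sigma> x)" for x
  define c where "c x = base' (h (orbit \<sigma> x))" for x
  have orb: "orbit \<sigma> (b x) = orbit \<sigma> x" for x
    unfolding b_def base_def by (rule orbit_eq_if_mem[OF p(1)]) (metis orbit_nonempty some_in_eq)
  have horb: "h (orbit \<sigma> x) \<in> orbit \<tau> ` B" if "x \<in> A" for x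
    using h(1) that by (auto simp: bij_betw_def)
  have orb': "orbit \<tau> (c x) = h (orbit \<sigma> x)" if x: "x \<in> A" for x
  proof -
    from horb[OF x] obtain y where y: "h (orbit \<sigma> x) = orbit \<tau> y" by auto
    show ?thesis unfolding c_def base'_def y
      by (rule orbit_eq_if_mem[OF p(2)]) (metis orbit_nonempty some_in_eq)
  qed
  \<comment> \<open>Paired orbits have the same size, so exponents are identified in the same way on
    both sides; this makes \<open>f\<close> both well defined and injective.\<close>
  have pow_eq: "(\<sigma> ^^ i) (b x) = (\<sigma> ^^ j) (b x) \<longleftrightarrow> (\<tau> ^^ i) (c x) = (\<tau> ^^ j) (c x)"
    if "x \<in> A" for x i j
    using h(2)[of "orbit \<sigma> x"] that
    by (simp add: funpow_eq_iff_cong[OF p(1)] funpow_eq_iff_cong[OF p(2)] orb orb')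
  define idx where "idx x = (SOME i. x = (\<sigma> ^^ i) (b x))" for x
  have idx: "x = (\<sigma> ^^ idx x) (b x)" for x
  proof -
    have "x \<in> orbit \<sigma> (b x)" using orb permutation_self_in_orbit[OF p(1)] by metis
    then have "\<exists>i. x = (\<sigma> ^^ i) (b x)" unfolding orbit_altdef_permutation[OF p(1)] by blast
    then show ?thesis unfolding idx_def by (rule someI_ex)
  qed
  define f where "f x = (\<tau> ^^ idx x) (c x)" for x
  have orbf: "orbit \<tau> (f x) = h (orbit \<sigma> x)" if "x \<in> A" for x
  proof -
    have "f x \<in> orbit \<tau> (c x)" unfolding f_def orbit_altdef_permutation[OF p(2)] by blast
    then show ?thesis using orbit_eq_if_mem[OF p(2)] orb'[OF that] by metis
  qed
  \<comment> \<open>The arbitrary exponent \<open>idx\<close> need not be compatible with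
    \<open>\<sigma>\<close>. Any other exponent gives the same \<open>f\<close>, in particular
    \<open>Suc (idx x)\<close> for the point \<open>\<sigma> x\<close>.\<close>
  have f_pow: "f y = (\<tau> ^^ i) (c x)" if x: "x \<in> A" and y: "y = (\<sigma> ^^ i) (b x)" for x y i
  proof -
    have "y \<in> orbit \<sigma> (b x)" unfolding y orbit_altdef_permutation[OF p(1)] by blast
    then have "orbit \<sigma> y = orbit \<sigma> x" using orbit_eq_if_mem[OF p(1)] orb by metis
    then have "b y = b x" "c y = c x" by (simp_all add: b_def c_def)
    then show ?thesis using pow_eq[OF x, of "idx y" i] idx[of y] y by (simp add: f_def)
  qed
  have mem: "(\<sigma> ^^ i) (b x) \<in> A" if "x \<in> A" for x i
  proof -
    have "(\<sigma> ^^ i) (b x) \<in> orbit \<sigma> (b x)" unfolding orbit_altdef_permutation[OF p(1)] by blast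
    then show ?thesis using permutes_orbit_subset[OF perm(1) that] orb by blast
  qed
  have "inj_on f A"
  proof (rule inj_onI)
    fix x y assume xy: "x \<in> A" "y \<in> A" "f x = f y"
    then have "h (orbit \<sigma> x) = h (orbit \<sigma> y)" using orbf by metis
    then have o: "orbit \<sigma> x = orbit \<sigma> y" using h(1) xy by (auto simp: bij_betw_def inj_on_def)
    then have "b y = b x" "c y = c x" by (simp_all add: b_def c_def)
    then have "(\<sigma> ^^ idx x) (b x) = (\<sigma> ^^ idx y) (b x)" using xy pow_eq[of x "idx x" "idx y"] by (simp add: f_def)
    then show "x = y" using idx[of x] idx[of y] \<open>b y = b x\<close> by simp
  qed
  moreover have "f ` A = B"
  proof
    show "f ` A \<subseteq> B"
    proof
      fix y assume "y \<in> f ` A"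
      then obtain x where x: "x \<in> A" "y = f x" by blast
      from horb[OF x(1)] obtain z where "z \<in> B" "orbit \<tau> y = orbit \<tau> z" using orbf[OF x(1)] x(2) by auto
      then show "y \<in> B" using permutes_orbit_subset[OF perm(2)] permutation_self_in_orbit[OF p(2), of y] by blast
    qed
    show "B \<subseteq> f ` A"
    proof
      fix y assume "y \<in> B"
      then have "orbit \<tau> y \<in> h ` (orbit \<sigma> ` A)" using h(1) by (simp add: bij_betw_def)
      then obtain x where x: "x \<in> A" "orbit \<tau> y = h (orbit \<sigma> x)" by blast
      then have "y \<in> orbit \<tau> (c x)" using orb' permutation_self_in_orbit[OF p(2), of y] by auto
      then obtain i where "y = (\<tau> ^^ i) (c x)" unfolding orbit_altdef_permutation[OF p(2)] by blast
      then have "y = f ((\<sigma> ^^ i) (b x))" using f_pow[OF x(1) refl] by simp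
      then show "y \<in> f ` A" using mem[OF x(1)] by blast
    qed
  qed
  moreover have "f (\<sigma> x) = \<tau> (f x)" if "x \<in> A" for x
  proof -
    have "\<sigma> x = (\<sigma> ^^ Suc (idx x)) (b x)" using idx[of x] by simp
    from f_pow[OF that this] show ?thesis by (simp add: f_def)
  qed
  ultimately show ?thesis using that by (simp add: bij_betw_def)
qed

section \<open>Rotations and reversals\<close>

text \<open>Exchange of the two adjacent blocks of lengths \<open>a\<close> and \<open>b\<close>
  after \<open>t\<close>, with inverse \<open>rotation t b a\<close>. Counted from
  \<open>t + 1\<close> it is addition of \<open>b\<close> modulo \<open>a + b\<close>.\<close>

definition rotation :: "nat \<Rightarrow> nat \<Rightarrow> nat \<Rightarrow> nat \<Rightarrow> nat" where
  "rotation t a b x = (if t < x \<and> x \<le> t + a then x + b else if t + a < x \<and> x \<le> t + a + b then x - a else x)"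

definition reversal :: "nat \<Rightarrow> nat \<Rightarrow> nat \<Rightarrow> nat" where
  "reversal t m x = (if t < x \<and> x \<le> t + m then 2 * t + m + 1 - x else x)"

lemma rotation_permutes: "rotation t a b permutes {t + 1..t + a + b}"
proof (rule bij_imp_permutes)
  show "bij_betw (rotation t a b) {t + 1..t + a + b} {t + 1..t + a + b}"
    by (rule bij_betw_byWitness[where f' = "rotation t b a"]) (auto simp: rotation_def)
qed (auto simp: rotation_def)

lemma reversal_permutes: "reversal t m permutes {t + 1..t + m}"
proof (rule bij_imp_permutes)
  show "bij_betw (reversal t m) {t + 1..t + m} {t + 1..t + m}"
    by (rule bij_betw_byWitness[where f' = "reversal t m"]) (auto simp: reversal_def)
qed (auto simp: reversal_def)

text \<open>By Bezout, the multiples of \<open>b\<close> modulo \<open>n\<close> are exactly the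
  multiples of \<open>gcd n b\<close>.\<close>

lemma orbit_add_mod:
  fixes n b x :: nat
  assumes "x < n"
  shows "orbit (\<lambda>y. (y + b) mod n) x = {y. y < n \<and> y mod gcd n b = x mod gcd n b}"
proof -
  let ?g = "gcd n b"
  have pow: "((\<lambda>y. (y + b) mod n) ^^ k) x = (x + b * k) mod n" for k
  proof (induction k)
    case (Suc k)
    then show ?case by (simp add: mod_simps algebra_simps)
  qed (use assms in simp)
  show ?thesis
  proof (intro equalityI subsetI)
    fix y assume "y \<in> orbit (\<lambda>y. (y + b) mod n) x"
    then obtain k where y: "y = (x + b * k) mod n" using pow by (auto simp: orbit_altdef)
    have "y mod ?g = (x + b * k) mod ?g" unfolding y by (rule mod_mod_cancel) simp
    moreover have "[x + b * k = x + 0] (mod ?g)" by (intro cong_add) (auto simp: cong_0_iff)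
    ultimately show "y \<in> {y. y < n \<and> y mod ?g = x mod ?g}" using assms y by (simp add: cong_def)
  next
    fix y assume "y \<in> {y. y < n \<and> y mod ?g = x mod ?g}"
    then have y: "y < n" "[y = x] (mod ?g)" by (auto simp: cong_def)
    \<comment> \<open>\<open>y + (n - x)\<close> stands for \<open>y - x\<close>, which might be
      negative.\<close>
    have "[y + (n - x) = x + (n - x)] (mod ?g)" using y(2) by (rule cong_add) simp
    also have "x + (n - x) = n" using assms by simp
    also have "[n = 0] (mod ?g)" by (simp add: cong_0_iff)
    finally obtain q where q: "y + (n - x) = ?g * q" by (auto simp: cong_0_iff dvd_def)
    obtain k where k: "[b * k = ?g] (mod n)" using cong_solve_nat[of b n] by (auto simp: gcd.commute)
    \<comment> \<open>The extra \<open>n\<close> contributes 0 modulo \<open>n\<close> but keeps the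
      exponent positive: orbits are built from at least one step, whereas \<open>k * q\<close> may
      be 0.\<close>
    have "[x + b * (k * q + n) = x + ?g * q] (mod n)"
    proof -
      have "[b * k * q = ?g * q] (mod n)" using k by (rule cong_scalar_right)
      moreover have "[b * n = 0] (mod n)" by (simp add: cong_0_iff)
      ultimately have "[b * k * q + b * n = ?g * q + 0] (mod n)" by (rule cong_add)
      then show ?thesis by (intro cong_add) (simp_all add: algebra_simps)
    qed
    also have "x + ?g * q = y + n" unfolding q[symmetric] using assms by simp
    finally have "(x + b * (k * q + n)) mod n = y" using y(1) by (simp add: cong_def)
    then have "y = ((\<lambda>y. (y + b) mod n) ^^ (k * q + n)) x" by (simp add: pow)
    moreover have "0 < k * q + n" using assms by simp
    ultimately show "y \<in> orbit (\<lambda>y. (y + b) mod n) x" unfolding orbit_altdef by blast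
  qed
qed

text \<open>The orbits are the residue classes modulo \<open>gcd n b\<close>, which divides
  \<open>n\<close>, so all classes below \<open>n\<close> have the same size.\<close>

lemma cycle_type_on_add_mod:
  fixes n b :: nat
  assumes "n \<noteq> 0"
  shows "cycle_type_on {..<n} (\<lambda>y. (y + b) mod n) = replicate_mset (gcd n b) (n div gcd n b)"
proof -
  define g where "g = gcd n b"
  have g: "0 < g" "g dvd n" using assms by (auto simp: g_def)
  define C where "C i = {y. y < n \<and> y mod g = i}" for i
  have "orbit (\<lambda>y. (y + b) mod n) ` {..<n} = (\<lambda>x. C (x mod g)) ` {..<n}"
    by (rule image_cong) (auto simp: orbit_add_mod g_def C_def)
  also have "\<dots> = C ` {..<g}"
  proof -
    have "g \<le> n" using g(2) assms by (simp add: dvd_imp_le)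
    then have "i \<in> (\<lambda>x. x mod g) ` {..<n}" if "i < g" for i
      using that by (intro image_eqI[of _ _ i]) auto
    then have "(\<lambda>x. x mod g) ` {..<n} = {..<g}" using g(1) by auto
    then show ?thesis by (metis image_image)
  qed
  finally have orbits: "orbit (\<lambda>y. (y + b) mod n) ` {..<n} = C ` {..<g}" .
  have inj: "inj_on C {..<g}"
  proof (rule inj_onI)
    fix i j assume ij: "i \<in> {..<g}" "C i = C j"
    have "g \<le> n" using g(2) assms by (simp add: dvd_imp_le)
    then have "i \<in> C i" using ij(1) by (simp add: C_def)
    then have "i \<in> C j" by (simp only: ij(2))
    then show "i = j" using ij(1) by (simp add: C_def)
  qed
  have card: "card (C i) = n div g" if "i < g" for i
  proof -
    have "C i = (\<lambda>j. i + g * j) ` {..<n div g}"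
    proof (intro equalityI subsetI)
      fix y assume "y \<in> C i"
      then have "y < n" "y = i + g * (y div g)" using mult_div_mod_eq[of g y] by (simp_all add: C_def)
      moreover have "y div g < n div g" 
        by (rule less_mult_imp_div_less) (use \<open>y < n\<close> g in simp)
      ultimately show "y \<in> (\<lambda>j. i + g * j) ` {..<n div g}" by blast
    next
      fix y assume "y \<in> (\<lambda>j. i + g * j) ` {..<n div g}"
      then obtain j where j: "y = i + g * j" "j < n div g" by blast
      have "g * Suc j \<le> n" using j(2) g(2) by (metis Suc_leI dvd_mult_div_cancel mult_le_mono2)
      then show "y \<in> C i" using that j(1) by (simp add: C_def)
    qed
    moreover have "inj_on (\<lambda>j. i + g * j) {..<n div g}" using g(1) by (auto simp: inj_on_def)
    ultimately show ?thesis by (simp add: card_image)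
  qed
  have "cycle_type_on {..<n} (\<lambda>y. (y + b) mod n) = image_mset card (image_mset C (mset_set {..<g}))"
    by (simp add: cycle_type_on_def orbits image_mset_mset_set[OF inj])
  also have "\<dots> = image_mset (\<lambda>_. n div g) (mset_set {..<g})"
    unfolding multiset.map_comp by (rule image_mset_cong) (use card in simp)
  finally show ?thesis by (simp add: image_mset_const_eq g_def)
qed

lemma cycle_type_on_rotation:
  "cycle_type_on {t + 1..t + a + b} (rotation t a b) = replicate_mset (gcd a b) ((a + b) div gcd a b)"
proof (cases "a + b = 0")
  case True
  then show ?thesis by (simp add: cycle_type_on_def)
next
  case False
  let ?n = "a + b" and ?f = "\<lambda>x. x + t + 1"
  have "cycle_type_on (?f ` {..<?n}) (rotation t a b) = cycle_type_on {..<?n} (\<lambda>y. (y + b) mod ?n)"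
  proof (rule cycle_type_on_image)
    fix y assume "y \<in> {..<?n}"
    then have "(y + b) mod ?n = (if y < a then y + b else y - a)"
      by (auto simp: mod_if)
    then show "?f ((y + b) mod ?n) = rotation t a b (?f y)"
      using \<open>y \<in> {..<?n}\<close> by (auto simp: rotation_def)
  qed (auto simp: inj_on_def intro!: mod_less_divisor)
  moreover have "?f ` {..<?n} = {t + 1..t + a + b}"
  proof -
    have "x \<in> ?f ` {..<?n}" if "x \<in> {t + 1..t + a + b}" for x
      by (rule image_eqI[of _ _ "x - t - 1"]) (use that in auto)
    then show ?thesis by auto
  qed
  moreover have "gcd ?n b = gcd a b" by simp
  ultimately show ?thesis using cycle_type_on_add_mod[OF False, of b] by simp
qed

text \<open>A reflection pairs points symmetric about the middle; one point is left over when
  \<open>m\<close> is odd.\<close>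

lemma cycle_type_on_reversal:
  "cycle_type_on {t + 1..t + m} (reversal t m) = replicate_mset (m div 2) 2 + replicate_mset (m mod 2) 1"
proof -
  \<comment> \<open>Without the case distinction of \<open>reversal\<close> the same map serves
    after the outermost pair is removed: raising \<open>t\<close> by 1 and lowering \<open>m\<close>
    by 2 keeps \<open>2 * t + m + 1\<close>.\<close>
  have "cycle_type_on {t + 1..t + m} (\<lambda>x. 2 * t + m + 1 - x) =
    replicate_mset (m div 2) 2 + replicate_mset (m mod 2) 1"
  proof (induction m arbitrary: t rule: induct_nat_012)
    case 0
    then show ?case by (simp add: cycle_type_on_def)
  next
    case 1
    then show ?case using cycle_type_on_id[of "{t + 1}" "\<lambda>x. 2 * t + Suc 0 + 1 - x"] by simp
  next
    case (ge2 m)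
    let ?\<sigma> = "\<lambda>x. 2 * t + Suc (Suc m) + 1 - x"
    let ?A = "{t + 1, t + m + 2}" and ?B = "{t + 2..t + m + 1}"
    have "{t + 1..t + Suc (Suc m)} = ?A \<union> ?B" by auto
    moreover have "cycle_type_on (?A \<union> ?B) ?\<sigma> = cycle_type_on ?A ?\<sigma> + cycle_type_on ?B ?\<sigma>"
      by (rule cycle_type_on_Un) auto
    moreover have "cycle_type_on ?A ?\<sigma> = {#2#}"
    proof -
      have s: "?\<sigma> (t + 1) = t + m + 2" "?\<sigma> (t + m + 2) = t + 1" by auto
      have "orbit ?\<sigma> x = ?A" if "x \<in> ?A" for x
      proof
        show "orbit ?\<sigma> x \<subseteq> ?A" by (rule orbit_subset_invariant) (use that s in auto)
        have "?\<sigma> x \<in> orbit ?\<sigma> x" "?\<sigma> (?\<sigma> x) \<in> orbit ?\<sigma> x" by (auto intro: orbit.intros)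
        then show "?A \<subseteq> orbit ?\<sigma> x" using that s by (auto simp del: diff_diff_left)
      qed
      then have "cycle_type_on ?A ?\<sigma> = {#card ?A#}" by (intro cycle_type_on_cyclic) auto
      then show ?thesis by simp
    qed
    moreover have "cycle_type_on ?B ?\<sigma> = replicate_mset (m div 2) 2 + replicate_mset (m mod 2) 1"
      using ge2.IH(1)[of "t + 1"] by (simp add: algebra_simps numeral_eq_Suc)
    moreover have "Suc (Suc m) div 2 = Suc (m div 2)" "Suc (Suc m) mod 2 = m mod 2" by simp_all
    ultimately show ?case by (simp only: replicate_mset_Suc) simp
  qed
  moreover have "cycle_type_on {t + 1..t + m} (\<lambda>x. 2 * t + m + 1 - x) = cycle_type_on {t + 1..t + m} (reversal t m)"
    by (rule cycle_type_on_cong) (auto simp: reversal_def)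
  ultimately show ?thesis by simp
qed

section \<open>Direct sums of permutations\<close>

lemma direct_sum_permutes:
  fixes \<tau> :: "nat \<Rightarrow> nat"
  assumes "\<tau> permutes {1..t}" "\<rho> permutes {t + 1..t + m}"
  shows "\<tau> \<circ> \<rho> permutes {1..t + m}"
  by (rule permutes_compose) (rule permutes_subset[OF assms(2)] permutes_subset[OF assms(1)], simp)+

lemma direct_sum_apply:
  fixes \<tau> :: "nat \<Rightarrow> nat"
  assumes "\<tau> permutes {1..t}" "\<rho> permutes {t + 1..t + m}"
  shows "x \<le> t \<Longrightarrow> (\<tau> \<circ> \<rho>) x = \<tau> x" "t < x \<Longrightarrow> (\<tau> \<circ> \<rho>) x = \<rho> x"
proof -
  show "(\<tau> \<circ> \<rho>) x = \<tau> x" if "x \<le> t" using permutes_not_in[OF assms(2), of x] that by simp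
  assume x: "t < x"
  have "t < \<rho> x"
  proof (cases "x \<in> {t + 1..t + m}")
    case True
    then have "\<rho> x \<in> {t + 1..t + m}" using permutes_in_image[OF assms(2)] by blast
    then show ?thesis by simp
  next
    case False
    then show ?thesis using permutes_not_in[OF assms(2) False] x by simp
  qed
  then show "(\<tau> \<circ> \<rho>) x = \<rho> x" using permutes_not_in[OF assms(1), of "\<rho> x"] by simp
qed

lemma cycle_type_direct_sum:
  fixes \<tau> :: "nat \<Rightarrow> nat"
  assumes "\<tau> permutes {1..t}" "\<rho> permutes {t + 1..t + m}"
  shows "cycle_type (t + m) (\<tau> \<circ> \<rho>) = cycle_type t \<tau> + cycle_type_on {t + 1..t + m} \<rho>"
proof -
  note app = direct_sum_apply[OF assms]
  have im: "(\<tau> \<circ> \<rho>) ` {1..t} = \<tau> ` {1..t}" "(\<tau> \<circ> \<rho>) ` {t + 1..t + m} = \<rho> ` {t + 1..t + m}"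
    using app by (auto intro!: image_cong)
  then have im': "(\<tau> \<circ> \<rho>) ` {1..t} = {1..t}" "(\<tau> \<circ> \<rho>) ` {t + 1..t + m} = {t + 1..t + m}"
    using permutes_image[OF assms(1)] permutes_image[OF assms(2)] by simp_all
  have "{1..t + m} = {1..t} \<union> {t + 1..t + m}" by auto
  then have "cycle_type (t + m) (\<tau> \<circ> \<rho>) = cycle_type_on {1..t} (\<tau> \<circ> \<rho>) + cycle_type_on {t + 1..t + m} (\<tau> \<circ> \<rho>)"
    unfolding cycle_type_eq by (simp only:) (rule cycle_type_on_Un; use im' in auto)
  moreover have "cycle_type_on {1..t} (\<tau> \<circ> \<rho>) = cycle_type_on {1..t} \<tau>"
    by (rule cycle_type_on_cong) (use im' app in auto)
  moreover have "cycle_type_on {t + 1..t + m} (\<tau> \<circ> \<rho>) = cycle_type_on {t + 1..t + m} \<rho>"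
    by (rule cycle_type_on_cong) (use im' app in auto)
  ultimately show ?thesis by (simp add: cycle_type_eq)
qed

lemma cycle_type_direct_sum_rotation:
  assumes "\<tau> permutes {1..t}"
  shows "cycle_type (t + (a + b)) (\<tau> \<circ> rotation t a b) =
    cycle_type t \<tau> + replicate_mset (gcd a b) ((a + b) div gcd a b)"
  using cycle_type_direct_sum[OF assms, of "rotation t a b" "a + b"] rotation_permutes[of t a b]
    cycle_type_on_rotation[of t a b] by (simp add: add.assoc)

lemma cycle_type_direct_sum_reversal:
  assumes "\<tau> permutes {1..t}"
  shows "cycle_type (t + m) (\<tau> \<circ> reversal t m) =
    cycle_type t \<tau> + (replicate_mset (m div 2) 2 + replicate_mset (m mod 2) 1)"
  using cycle_type_direct_sum[OF assms reversal_permutes] cycle_type_on_reversal[of t m] by simp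

lemma direct_sum_rotation_permutes:
  "\<tau> permutes {1..t} \<Longrightarrow> \<tau> \<circ> rotation t a b permutes {1..t + (a + b)}"
  by (rule direct_sum_permutes) (use rotation_permutes[of t a b] in \<open>simp_all add: add.assoc\<close>)

text \<open>Cycles are appended one at a time: blocks of lengths \<open>l - 1\<close> and 1 have gcd
  1, so their rotation is a single cycle of length \<open>l\<close>.\<close>

lemma integer_partition_realizable:
  assumes "integer_partition \<mu>"
  obtains t \<tau> where "\<tau> permutes {1..t}" "cycle_type t \<tau> = \<mu>"
proof -
  have "\<exists>t \<tau>. \<tau> permutes {1..t} \<and> cycle_type t \<tau> = \<mu>"
    using assms
  proof (induction \<mu>)
    case empty
    have "id permutes {1..0::nat}" "cycle_type 0 id = {#}" by (simp_all add: cycle_type_def permutes_def)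
    then show ?case by blast
  next
    case (add l \<mu>)
    then have "integer_partition \<mu>" "0 < l" by (auto simp: integer_partition_def)
    then obtain t \<tau> where \<tau>: "\<tau> permutes {1..t}" "cycle_type t \<tau> = \<mu>" using add.IH by blast
    have "cycle_type (t + (l - 1 + 1)) (\<tau> \<circ> rotation t (l - 1) 1) = add_mset l \<mu>"
      using cycle_type_direct_sum_rotation[OF \<tau>(1), of "l - 1" 1] \<open>0 < l\<close> \<tau>(2) by simp
    then show ?case using direct_sum_rotation_permutes[OF \<tau>(1)] by blast
  qed
  then show ?thesis using that by blast
qed

section \<open>Interchanging long monotone runs\<close>

text \<open>Each point of \<open>\<tau>\<close> is a run of length 1; the two increasing blocks of the rotation are the
  runs \<open>t + 1\<close> and \<open>t + 2\<close>.\<close>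

definition rotation_lengths :: "nat \<Rightarrow> nat \<Rightarrow> nat \<Rightarrow> nat \<Rightarrow> nat" where
  "rotation_lengths t a b c =
     (if 1 \<le> c \<and> c \<le> t then 1 else if c = t + 1 then a else if c = t + 2 then b else 0)"

text \<open>Shrinking both blocks to single points keeps every comparison between different runs:
  \<open>t + 1\<close> precedes \<open>t + 2\<close> by position and follows it by value. Nothing
  here depends on \<open>a\<close> and \<open>b\<close>.\<close>

definition rotation_order :: "nat \<Rightarrow> (nat \<Rightarrow> nat) \<Rightarrow> toto_sym \<Rightarrow> nat \<Rightarrow> nat \<Rightarrow> bool" where
  "rotation_order t \<tau> = toto_pos_rel (\<tau> \<circ> rotation t 1 1)"

text \<open>On the right only the run lengths depend on \<open>a\<close> and \<open>b\<close>, so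
  the game applies to a change of these two numbers.\<close>

lemma satisfies_direct_sum_rotation:
  assumes \<tau>: "\<tau> permutes {1..t}" and "sentence \<phi>"
  shows "satisfies {1..t + (a + b)} (toto_pos_rel (\<tau> \<circ> rotation t a b)) \<phi> \<longleftrightarrow>
    satisfies (run_dom (rotation_lengths t a b)) (run_rel (rotation_order t \<tau>) (\<lambda>_ _. True)) \<phi>"
proof (rule satisfies_iso)
  let ?f = "\<lambda>x. if x \<le> t then (x, 0) else if x \<le> t + a then (t + 1, int (x - t - 1))
    else (t + 2, int (x - t - a - 1))"
  let ?g = "\<lambda>(c, i). if c \<le> t then c else if c = t + 1 then t + 1 + nat i else t + a + 1 + nat i"
  show "bij_betw ?f {1..t + (a + b)} (run_dom (rotation_lengths t a b))"
  proof (rule bij_betw_byWitness[where f' = ?g])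
    show "\<forall>x\<in>{1..t + (a + b)}. ?g (?f x) = x" by auto
    show "?f ` {1..t + (a + b)} \<subseteq> run_dom (rotation_lengths t a b)"
      by (auto simp: run_dom_def rotation_lengths_def)
    have *: "?f (?g (c, i)) = (c, i) \<and> ?g (c, i) \<in> {1..t + (a + b)}"
      if z: "(c, i) \<in> run_dom (rotation_lengths t a b)" for c i
    proof -
      have "1 \<le> c \<and> c \<le> t \<and> i = 0 \<or> c = t + 1 \<and> 0 \<le> i \<and> i < int a \<or> c = t + 2 \<and> 0 \<le> i \<and> i < int b"
        using z by (auto simp: run_dom_def rotation_lengths_def split: if_splits)
      then show ?thesis by (elim disjE) auto
    qed
    show "\<forall>z\<in>run_dom (rotation_lengths t a b). ?f (?g z) = z" using * by fast
    show "?g ` run_dom (rotation_lengths t a b) \<subseteq> {1..t + (a + b)}" using * by fast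
  qed
  have le: "\<tau> x \<le> t" if "x \<le> t" for x
  proof (cases "x = 0")
    case True
    then show ?thesis using permutes_not_in[OF \<tau>, of 0] by simp
  next
    case False
    then show ?thesis using permutes_in_image[OF \<tau>, of x] that by simp
  qed
  have val: "(\<tau> \<circ> rotation t a b) x = (if x \<le> t then \<tau> x else rotation t a b x)" for x a b
    using direct_sum_apply[OF \<tau>, of "rotation t a b" "a + b" x] rotation_permutes[of t a b]
    by (simp add: add.assoc)
  fix r x y assume xy: "x \<in> {1..t + (a + b)}" "y \<in> {1..t + (a + b)}"
  show "toto_pos_rel (\<tau> \<circ> rotation t a b) r x y \<longleftrightarrow>
    run_rel (rotation_order t \<tau>) (\<lambda>_ _. True) r (?f x) (?f y)"
  proof (cases r)
    case LessP
    then show ?thesis using xy by (auto simp: run_rel_def rotation_order_def)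
  next
    case LessV
    then show ?thesis using xy le[of x] le[of y]
      by (simp add: run_rel_def rotation_order_def val rotation_def del: comp_apply) linarith
  qed
qed fact

definition reversal_lengths :: "nat \<Rightarrow> nat \<Rightarrow> nat \<Rightarrow> nat" where
  "reversal_lengths t m c = (if 1 \<le> c \<and> c \<le> t then 1 else if c = t + 1 then m else 0)"

text \<open>Along the appended run positions follow the index and values go against it, hence the
  direction \<open>r = LessP\<close>.\<close>

lemma satisfies_direct_sum_reversal:
  assumes \<tau>: "\<tau> permutes {1..t}" and "sentence \<phi>"
  shows "satisfies {1..t + m} (toto_pos_rel (\<tau> \<circ> reversal t m)) \<phi> \<longleftrightarrow>
    satisfies (run_dom (reversal_lengths t m)) (run_rel (toto_pos_rel \<tau>) (\<lambda>r _. r = LessP)) \<phi>"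
proof (rule satisfies_iso)
  let ?f = "\<lambda>x. if x \<le> t then (x, 0) else (t + 1, int (x - t - 1))"
  let ?g = "\<lambda>(c, i). if c \<le> t then c else t + 1 + nat i"
  show "bij_betw ?f {1..t + m} (run_dom (reversal_lengths t m))"
  proof (rule bij_betw_byWitness[where f' = ?g])
    show "\<forall>x\<in>{1..t + m}. ?g (?f x) = x" by auto
    show "?f ` {1..t + m} \<subseteq> run_dom (reversal_lengths t m)"
      by (auto simp: run_dom_def reversal_lengths_def)
    have *: "?f (?g (c, i)) = (c, i) \<and> ?g (c, i) \<in> {1..t + m}"
      if z: "(c, i) \<in> run_dom (reversal_lengths t m)" for c i
    proof -
      have "1 \<le> c \<and> c \<le> t \<and> i = 0 \<or> c = t + 1 \<and> 0 \<le> i \<and> i < int m"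
        using z by (auto simp: run_dom_def reversal_lengths_def split: if_splits)
      then show ?thesis by (elim disjE) auto
    qed
    show "\<forall>z\<in>run_dom (reversal_lengths t m). ?f (?g z) = z" using * by fast
    show "?g ` run_dom (reversal_lengths t m) \<subseteq> {1..t + m}" using * by fast
  qed
  have le: "\<tau> x \<le> t" if "x \<le> t" for x
  proof (cases "x = 0")
    case True
    then show ?thesis using permutes_not_in[OF \<tau>, of 0] by simp
  next
    case False
    then show ?thesis using permutes_in_image[OF \<tau>, of x] that by simp
  qed
  \<comment> \<open>The reversed run is represented by the position \<open>t + 1\<close>; extended
    by the identity, \<open>\<tau>\<close> puts it above all of its own values, as it should
    be.\<close>
  have t1: "\<tau> (Suc t) = Suc t" using permutes_not_in[OF \<tau>, of "Suc t"] by simp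
  have val: "(\<tau> \<circ> reversal t m) x = (if x \<le> t then \<tau> x else reversal t m x)" for x
    using direct_sum_apply[OF \<tau> reversal_permutes] by simp
  fix r x y assume xy: "x \<in> {1..t + m}" "y \<in> {1..t + m}"
  show "toto_pos_rel (\<tau> \<circ> reversal t m) r x y \<longleftrightarrow>
    run_rel (toto_pos_rel \<tau>) (\<lambda>r _. r = LessP) r (?f x) (?f y)"
  proof (cases r)
    case LessP
    then show ?thesis using xy by (auto simp: run_rel_def)
  next
    case LessV
    then show ?thesis using xy le[of x] le[of y] t1
      by (simp add: run_rel_def val reversal_def del: comp_apply) linarith
  qed
qed fact

section \<open>Definable sets of permutations\<close>

definition toto_definable :: "(nat \<times> (nat \<Rightarrow> nat)) set \<Rightarrow> bool" where
  "toto_definable E \<longleftrightarrow> (\<exists>\<phi>. sentence \<phi> \<and> toto_models \<phi> = E)"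

definition toob_definable :: "(nat \<times> (nat \<Rightarrow> nat)) set \<Rightarrow> bool" where
  "toob_definable E \<longleftrightarrow> (\<exists>\<phi>. sentence \<phi> \<and> toob_models \<phi> = E)"

lemma toto_toob_set_iff: "toto_toob_set E \<longleftrightarrow> toto_definable E \<and> toob_definable E"
  by (simp add: toto_toob_set_def toto_definable_def toob_definable_def)

lemma sentence_simps:
  "sentence (Neg \<phi>) \<longleftrightarrow> sentence \<phi>" "sentence (Conj \<phi> \<psi>) \<longleftrightarrow> sentence \<phi> \<and> sentence \<psi>"
  by (simp_all add: sentence_def)

lemma satisfies_Neg: "sentence \<phi> \<Longrightarrow> satisfies D I (Neg \<phi>) \<longleftrightarrow> \<not> satisfies D I \<phi>"
  using satisfies_sentence[of \<phi> D I undefined] satisfies_sentence[of "Neg \<phi>" D I undefined]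
  by (simp add: sentence_simps)

lemma satisfies_Conj: "satisfies D I (Conj \<phi> \<psi>) \<longleftrightarrow> satisfies D I \<phi> \<and> satisfies D I \<psi>"
  by (auto simp: satisfies_def)

lemma toto_definable_Diff:
  assumes "toto_definable E"
  shows "toto_definable (perms - E)"
proof -
  from assms obtain \<phi> where "sentence \<phi>" "toto_models \<phi> = E" by (auto simp: toto_definable_def)
  then have "sentence (Neg \<phi>)" "toto_models (Neg \<phi>) = perms - E"
    by (auto simp: sentence_simps toto_models_def satisfies_Neg)
  then show ?thesis unfolding toto_definable_def by blast
qed

lemma toob_definable_Diff:
  assumes "toob_definable E"
  shows "toob_definable (perms - E)"
proof -
  from assms obtain \<phi> where "sentence \<phi>" "toob_models \<phi> = E" by (auto simp: toob_definable_def)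
  then have "sentence (Neg \<phi>)" "toob_models (Neg \<phi>) = perms - E"
    by (auto simp: sentence_simps toob_models_def satisfies_Neg)
  then show ?thesis unfolding toob_definable_def by blast
qed

lemma toto_definable_Int:
  assumes "toto_definable E" "toto_definable F"
  shows "toto_definable (E \<inter> F)"
proof -
  from assms obtain \<phi> \<psi> where "sentence \<phi>" "toto_models \<phi> = E" "sentence \<psi>" "toto_models \<psi> = F"
    by (auto simp: toto_definable_def)
  then have "sentence (Conj \<phi> \<psi>)" "toto_models (Conj \<phi> \<psi>) = E \<inter> F"
    by (auto simp: sentence_simps toto_models_def satisfies_Conj)
  then show ?thesis unfolding toto_definable_def by blast
qed

lemma toob_definable_Int:
  assumes "toob_definable E" "toob_definable F"
  shows "toob_definable (E \<inter> F)"
proof -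
  from assms obtain \<phi> \<psi> where "sentence \<phi>" "toob_models \<phi> = E" "sentence \<psi>" "toob_models \<psi> = F"
    by (auto simp: toob_definable_def)
  then have "sentence (Conj \<phi> \<psi>)" "toob_models (Conj \<phi> \<psi>) = E \<inter> F"
    by (auto simp: sentence_simps toob_models_def satisfies_Conj)
  then show ?thesis unfolding toob_definable_def by blast
qed

lemma toto_definable_subset: "toto_definable E \<Longrightarrow> E \<subseteq> perms"
  by (auto simp: toto_definable_def toto_models_def)

lemma toob_definable_subset: "toob_definable E \<Longrightarrow> E \<subseteq> perms"
  by (auto simp: toob_definable_def toob_models_def)

lemma toto_definableI:
  assumes "expressible {} P" "E \<subseteq> perms"
    and "\<And>n \<sigma>. (n, \<sigma>) \<in> perms \<Longrightarrow> (n, \<sigma>) \<in> E \<longleftrightarrow> P {1..n} (toto_pos_rel \<sigma>) (\<lambda>_. 0)"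
  shows "toto_definable E"
proof -
  obtain \<phi> where \<phi>: "sentence \<phi>" "\<And>D I v. satisfies D I \<phi> \<longleftrightarrow> P D I v"
    using expressible_sentence[OF assms(1)] by blast
  have "toto_models \<phi> = E"
    using assms(2,3) by (auto simp: toto_models_def satisfies_toto_dom[OF \<phi>(1)] \<phi>(2)[of _ _ "\<lambda>_. 0"])
  then show ?thesis using \<phi>(1) by (auto simp: toto_definable_def)
qed

lemma toob_definableI:
  assumes "expressible {} P" "E \<subseteq> perms"
    and "\<And>n \<sigma>. (n, \<sigma>) \<in> perms \<Longrightarrow> (n, \<sigma>) \<in> E \<longleftrightarrow> P {1..n} (toob_rel \<sigma>) (\<lambda>_. 0)"
  shows "toob_definable E"
proof -
  obtain \<phi> where \<phi>: "sentence \<phi>" "\<And>D I v. satisfies D I \<phi> \<longleftrightarrow> P D I v"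
    using expressible_sentence[OF assms(1)] by blast
  have "toob_models \<phi> = E"
    using assms(2,3) by (auto simp: toob_models_def \<phi>(2)[of _ _ "\<lambda>_. 0"])
  then show ?thesis using \<phi>(1) by (auto simp: toob_definable_def)
qed

lemma expressible_empty: "expressible X (\<lambda>D I v. False)"
  using expressible_not[OF expressible_True] by simp

text \<open>Each logic is closed under its connectives, hence so is definability in both. The
  generated algebra, being the smallest, lies inside as soon as its generators do.\<close>

lemma algebra_toto_toob: "algebra perms {E. toto_toob_set E}"
  unfolding algebra_iff_Int
proof (intro conjI ballI)
  show "{E. toto_toob_set E} \<subseteq> Pow perms" using toto_definable_subset by (auto simp: toto_toob_set_iff)
  have "toto_definable {}" by (rule toto_definableI[OF expressible_empty]) auto
  moreover have "toob_definable {}" by (rule toob_definableI[OF expressible_empty]) auto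
  ultimately show "{} \<in> {E. toto_toob_set E}" by (simp add: toto_toob_set_iff)
qed (auto simp: toto_toob_set_iff
       intro: toto_definable_Diff toob_definable_Diff toto_definable_Int toob_definable_Int)

lemma toto_definable_UN:
  assumes "finite A" "\<And>i. i \<in> A \<Longrightarrow> toto_definable (E i)"
  shows "toto_definable (\<Union>i\<in>A. E i)"
  using assms
proof (induction A)
  case empty
  then show ?case by (intro toto_definableI[OF expressible_empty]) auto
next
  case (insert j A)
  then have "toto_definable (E j)" "toto_definable (\<Union>i\<in>A. E i)" by auto
  moreover from this have "E j \<union> (\<Union>i\<in>A. E i) = perms - ((perms - E j) \<inter> (perms - (\<Union>i\<in>A. E i)))"
    using toto_definable_subset by blast
  ultimately show ?case
    by (simp add: toto_definable_Diff toto_definable_Int)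
qed

lemma expressible_allI:
  assumes "expressible (insert x X) P" "\<And>D I v a. a \<in> D \<Longrightarrow> Q D I v a \<longleftrightarrow> P D I (v(x := a))"
  shows "expressible X (\<lambda>D I v. \<forall>a\<in>D. Q D I v a)"
  using expressible_all[OF assms(1)] assms(2) by (simp cong: ball_cong)

lemma expressible_exsI:
  assumes "expressible {1..k} P"
    and "\<And>D I v p. p \<in> {1..k} \<rightarrow> D \<Longrightarrow> Q D I p \<longleftrightarrow> P D I (\<lambda>x. if x \<in> {1..k} then p x else v x)"
  shows "expressible {} (\<lambda>D I v. \<exists>p\<in>{1..k} \<rightarrow> D. Q D I p)"
proof -
  have "expressible {} (\<lambda>D I v. \<exists>p\<in>{1..k} \<rightarrow> D. P D I (\<lambda>x. if x \<in> {1..k} then p x else v x))"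
    by (rule expressible_exs) (use assms(1) in simp)
  moreover have "(\<lambda>D I v. \<exists>p\<in>{1..k} \<rightarrow> D. P D I (\<lambda>x. if x \<in> {1..k} then p x else v x)) =
      (\<lambda>D I v. \<exists>p\<in>{1..k} \<rightarrow> D. Q D I p)"
    by (intro ext bex_cong refl) (use assms(2) in blast)
  ultimately show ?thesis by simp
qed

section \<open>Permutations that are a fixed pattern plus fixed points\<close>

text \<open>\<open>p\<close> conjugates \<open>\<tau>\<close> to the restriction of
  \<open>\<sigma>\<close> to the image of \<open>p\<close>. When \<open>\<tau>\<close> has fixed
  points, the image is larger than the set of moved points; this accounts for parts 1 in
  \<open>\<mu>\<close>.\<close>

definition moved_by :: "nat \<Rightarrow> (nat \<Rightarrow> nat) \<Rightarrow> nat \<Rightarrow> (nat \<Rightarrow> nat) \<Rightarrow> (nat \<Rightarrow> nat) \<Rightarrow> bool" where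
  "moved_by k \<tau> n \<sigma> p \<longleftrightarrow> p \<in> {1..k} \<rightarrow> {1..n} \<and> inj_on p {1..k} \<and>
     (\<forall>i\<in>{1..k}. \<sigma> (p i) = p (\<tau> i)) \<and> (\<forall>y\<in>{1..n}. y \<notin> p ` {1..k} \<longrightarrow> \<sigma> y = y)"

lemma cycle_type_moved_by:
  assumes "\<tau> permutes {1..k}" "moved_by k \<tau> n \<sigma> p"
  shows "cycle_type_on (p ` {1..k}) \<sigma> = cycle_type k \<tau>"
    and "cycle_type n \<sigma> = cycle_type k \<tau> + replicate_mset (n - k) 1"
proof -
  let ?S = "p ` {1..k}"
  have im: "\<tau> ` {1..k} = {1..k}" by (rule permutes_image[OF assms(1)])
  have p: "p \<in> {1..k} \<rightarrow> {1..n}" "inj_on p {1..k}" "\<And>i. i \<in> {1..k} \<Longrightarrow> \<sigma> (p i) = p (\<tau> i)"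
    "\<And>y. y \<in> {1..n} - ?S \<Longrightarrow> \<sigma> y = y"
    using assms(2) by (auto simp: moved_by_def)
  show *: "cycle_type_on ?S \<sigma> = cycle_type k \<tau>"
    unfolding cycle_type_eq by (rule cycle_type_on_image) (use im p in auto)
  have sub: "?S \<subseteq> {1..n}" using p(1) by auto
  have "card ({1..n} - ?S) = n - k"
    using card_Diff_subset[OF _ sub] card_image[OF p(2)] by simp
  then have "cycle_type_on ({1..n} - ?S) \<sigma> = replicate_mset (n - k) 1"
    using cycle_type_on_id[of "{1..n} - ?S" \<sigma>] p(4) by simp
  moreover have "cycle_type_on (?S \<union> ({1..n} - ?S)) \<sigma> = cycle_type_on ?S \<sigma> + cycle_type_on ({1..n} - ?S) \<sigma>"
  proof (rule cycle_type_on_Un)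
    have "\<sigma> ` ?S = p ` \<tau> ` {1..k}" unfolding image_image by (rule image_cong) (use p(3) in auto)
    then show "\<sigma> ` ?S \<subseteq> ?S" by (simp only: im subset_refl)
    show "\<sigma> ` ({1..n} - ?S) \<subseteq> {1..n} - ?S" using p(4) by auto
  qed auto
  moreover have "?S \<union> ({1..n} - ?S) = {1..n}" using sub by blast
  ultimately show "cycle_type n \<sigma> = cycle_type k \<tau> + replicate_mset (n - k) 1"
    using * by (simp add: cycle_type_eq)
qed

lemma moved_by_if_cycle_type:
  assumes "\<tau> permutes {1..k}" "\<sigma> permutes {1..n}" "cycle_type n \<sigma> = cycle_type k \<tau> + replicate_mset j 1"
  obtains p where "moved_by k \<tau> n \<sigma> p" "n = k + j"
proof -
  \<comment> \<open>A rotation with empty second block is the identity with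
    \<open>gcd j 0 = j\<close> cycles of length 1, so the rotation lemmas also append
    \<open>j\<close> fixed points to \<open>\<tau>\<close>.\<close>
  let ?\<tau> = "\<tau> \<circ> rotation k j 0"
  have "rotation k j 0 = id" by (auto simp: rotation_def)
  then have \<tau>: "?\<tau> = \<tau>" by simp
  have type: "cycle_type (k + j) \<tau> = cycle_type k \<tau> + replicate_mset j 1"
    using cycle_type_direct_sum_rotation[OF assms(1), of j 0] \<tau> by (cases "j = 0") simp_all
  have perm: "\<tau> permutes {1..k + j}" using direct_sum_rotation_permutes[OF assms(1), of j 0] \<tau> by simp
  obtain f where f: "bij_betw f {1..k + j} {1..n}" "\<And>x. x \<in> {1..k + j} \<Longrightarrow> f (\<tau> x) = \<sigma> (f x)"
    by (rule conjugate_if_cycle_type_on_eq[of "{1..k + j}" "{1..n}" \<tau> \<sigma>])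
       (use assms perm type in \<open>auto simp: cycle_type_eq\<close>)
  have "\<sigma> y = y" if "y \<in> {1..n}" "y \<notin> f ` {1..k}" for y
  proof -
    have "y \<in> f ` {1..k + j}" using f(1) that(1) by (simp add: bij_betw_def)
    then obtain x where x: "y = f x" "x \<in> {1..k + j}" by blast
    then have "\<tau> x = x" using that(2) permutes_not_in[OF assms(1), of x] by blast
    then show ?thesis using f(2)[OF x(2)] x(1) by simp
  qed
  moreover have "inj_on f {1..k}"
    by (rule inj_on_subset[OF bij_betw_imp_inj_on[OF f(1)]]) simp
  moreover have "f \<in> {1..k} \<rightarrow> {1..n}" using bij_betwE[OF f(1)] by simp
  moreover have "\<sigma> (f i) = f (\<tau> i)" if "i \<in> {1..k}" for i using f(2)[of i] that by simp
  ultimately have "moved_by k \<tau> n \<sigma> f" unfolding moved_by_def by blast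
  moreover have "n = k + j" using bij_betw_same_card[OF f(1)] by simp
  ultimately show ?thesis using that by blast
qed

text \<open>Replaces a union over infinitely many cycle types by the existence of \<open>k\<close>
  points, with \<open>k\<close> fixed, which is within reach of first-order logic.\<close>

lemma \<D>_eq_moved_by:
  assumes "\<tau> permutes {1..k}"
  shows "\<D> (cycle_type k \<tau>) = {(n, \<sigma>) \<in> perms. \<exists>p. moved_by k \<tau> n \<sigma> p}"
proof (intro equalityI subsetI)
  fix x assume "x \<in> \<D> (cycle_type k \<tau>)"
  then obtain n \<sigma> j where x: "x = (n, \<sigma>)" "(n, \<sigma>) \<in> perms" "\<sigma> permutes {1..n}"
    "cycle_type n \<sigma> = cycle_type k \<tau> + replicate_mset j 1"
    by (auto simp: \<D>_def \<C>_def perms_def)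
  obtain p where "moved_by k \<tau> n \<sigma> p" by (rule moved_by_if_cycle_type[OF assms x(3,4)])
  then show "x \<in> {(n, \<sigma>) \<in> perms. \<exists>p. moved_by k \<tau> n \<sigma> p}" using x(1,2) by blast
next
  fix x assume "x \<in> {(n, \<sigma>) \<in> perms. \<exists>p. moved_by k \<tau> n \<sigma> p}"
  then obtain n \<sigma> p where x: "x = (n, \<sigma>)" "(n, \<sigma>) \<in> perms" "moved_by k \<tau> n \<sigma> p" by blast
  then have "x \<in> \<C> (cycle_type k \<tau> + replicate_mset (n - k) 1)"
    using cycle_type_moved_by(2)[OF assms x(3)] by (simp add: \<C>_def)
  then show "x \<in> \<D> (cycle_type k \<tau>)" unfolding \<D>_def by blast
qed

text \<open>TOTO sees the listed points through their order, so \<open>p\<close> is taken to be the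
  increasing enumeration of the same set \<open>S\<close>. The price is a conjugate pattern
  \<open>\<tau>'\<close>, of the same cycle type because both describe \<open>\<sigma>\<close> on
  \<open>S\<close>.\<close>

lemma moved_by_sorted:
  assumes "\<sigma> permutes {1..n}" "\<tau> permutes {1..k}" "moved_by k \<tau> n \<sigma> q"
  obtains \<tau>' p where "\<tau>' permutes {1..k}" "cycle_type k \<tau>' = cycle_type k \<tau>"
    "moved_by k \<tau>' n \<sigma> p" "strict_mono_on {1..k} p"
proof -
  define S where "S = q ` {1..k}"
  have q: "q \<in> {1..k} \<rightarrow> {1..n}" "inj_on q {1..k}" "\<And>i. i \<in> {1..k} \<Longrightarrow> \<sigma> (q i) = q (\<tau> i)"
    "\<And>y. y \<in> {1..n} \<Longrightarrow> y \<notin> S \<Longrightarrow> \<sigma> y = y"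
    using assms(3) unfolding moved_by_def S_def by blast+
  have S: "finite S" "card S = k" "S \<subseteq> {1..n}" using q(1) card_image[OF q(2)] by (auto simp: S_def)
  have "\<sigma> ` S = q ` \<tau> ` {1..k}"
    unfolding S_def image_image by (rule image_cong) (use q(3) in auto)
  then have \<sigma>S: "\<sigma> ` S = S" using permutes_image[OF assms(2)] by (simp add: S_def)
  obtain h where h: "bij_betw h {..<k} S" "strict_mono_on {..<k} h"
    using ex_bij_betw_strict_mono_card[OF S(1)] S(2) by metis
  define p where "p = h \<circ> (\<lambda>i. i - 1)"
  have "bij_betw (\<lambda>i. i - 1) {1..k} {..<k}"
    by (rule bij_betw_byWitness[where f' = Suc]) auto
  from bij_betw_trans[OF this h(1)] have p: "bij_betw p {1..k} S" unfolding p_def .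
  have mono: "strict_mono_on {1..k} p"
  proof (rule strict_mono_onI)
    fix i j assume "i \<in> {1..k}" "j \<in> {1..k}" "i < j"
    then show "p i < p j" using strict_mono_onD[OF h(2), of "i - 1" "j - 1"] by (simp add: p_def)
  qed
  define \<tau>' where "\<tau>' i = (if i \<in> {1..k} then inv_into {1..k} p (\<sigma> (p i)) else i)" for i
  have "bij_betw \<sigma> S S"
    using \<sigma>S inj_on_subset[OF permutes_inj[OF assms(1)], of S] by (simp add: bij_betw_def)
  from bij_betw_trans[OF bij_betw_trans[OF p this] bij_betw_inv_into[OF p]]
  have "bij_betw (inv_into {1..k} p \<circ> (\<sigma> \<circ> p)) {1..k} {1..k}" .
  moreover have "bij_betw \<tau>' {1..k} {1..k} \<longleftrightarrow> bij_betw (inv_into {1..k} p \<circ> (\<sigma> \<circ> p)) {1..k} {1..k}"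
    by (rule bij_betw_cong) (simp add: \<tau>'_def)
  ultimately have "bij_betw \<tau>' {1..k} {1..k}" by blast
  then have \<tau>': "\<tau>' permutes {1..k}" by (rule bij_imp_permutes) (auto simp: \<tau>'_def)
  have pS: "p ` {1..k} = S" using p by (simp add: bij_betw_def)
  have "\<sigma> (p i) = p (\<tau>' i)" if "i \<in> {1..k}" for i
  proof -
    have "\<sigma> (p i) \<in> p ` {1..k}" using that pS \<sigma>S by blast
    then show ?thesis using that by (simp add: \<tau>'_def f_inv_into_f)
  qed
  then have moved: "moved_by k \<tau>' n \<sigma> p" using p S(3) q(4) pS
    unfolding moved_by_def bij_betw_def by blast
  have "cycle_type k \<tau>' = cycle_type k \<tau>"
    using cycle_type_moved_by(1)[OF \<tau>' moved] cycle_type_moved_by(1)[OF assms(2,3)] pS by (simp add: S_def)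
  then show ?thesis using that \<tau>' moved mono by blast
qed

section \<open>Describing a pattern by the two orders alone\<close>

text \<open>\<open>\<sigma>' \<circ> inv \<sigma>\<close> is strictly increasing on
  \<open>{1..n}\<close>, hence the identity. This rigidity recovers a permutation from comparisons
  of its values.\<close>

lemma permutes_eq_if_order_eq:
  fixes \<sigma> \<sigma>' :: "nat \<Rightarrow> nat"
  assumes "\<sigma> permutes {1..n}" "\<sigma>' permutes {1..n}"
    and "\<And>x y. x \<in> {1..n} \<Longrightarrow> y \<in> {1..n} \<Longrightarrow> \<sigma> x < \<sigma> y \<Longrightarrow> \<sigma>' x < \<sigma>' y"
  shows "\<sigma>' = \<sigma>"
proof -
  define g where "g = \<sigma>' \<circ> inv \<sigma>"
  have inv: "inv \<sigma> permutes {1..n}" "\<And>x. \<sigma> (inv \<sigma> x) = x"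
    using permutes_inv[OF assms(1)] permutes_inverses(1)[OF assms(1)] by blast+
  have g: "g permutes {1..n}" unfolding g_def by (rule permutes_compose[OF inv(1) assms(2)])
  have mono: "g x < g y" if "x \<in> {1..n}" "y \<in> {1..n}" "x < y" for x y
    using assms(3)[of "inv \<sigma> x" "inv \<sigma> y"] permutes_in_image[OF inv(1)] that by (simp add: inv(2) g_def)
  have "i \<in> {1..n} \<longrightarrow> i \<le> g i" for i
  proof (induction i)
    case (Suc i)
    show ?case
    proof
      assume i: "Suc i \<in> {1..n}"
      show "Suc i \<le> g (Suc i)"
      proof (cases "i = 0")
        case True
        have "g (Suc i) \<in> {1..n}" using permutes_in_image[OF g] i by blast
        then show ?thesis using True by simp
      next
        case False
        then have "i \<le> g i" "g i < g (Suc i)" using Suc mono[of i "Suc i"] i by auto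
        then show ?thesis by simp
      qed
    qed
  qed simp
  then have "g = id" using permutes_natset_ge[OF g] by blast
  then have "\<sigma>' (inv \<sigma> (\<sigma> x)) = \<sigma> x" for x by (metis comp_apply g_def id_apply)
  then show ?thesis using permutes_inverses(2)[OF assms(1)] by (simp add: fun_eq_iff)
qed

text \<open>Removes the equations between values and positions: on the right, positions are compared
  with positions and values with values. As unlisted points are fixed, the position bound
  \<open>p (\<tau> i) < a\<close> can be traded for the value bound
  \<open>\<sigma> (p i) < \<sigma> a\<close>.\<close>

lemma moved_by_iff_order:
  assumes \<sigma>: "\<sigma> permutes {1..n}" and \<tau>: "\<tau> permutes {1..k}" and p: "p \<in> {1..k} \<rightarrow> {1..n}"
  shows "moved_by k \<tau> n \<sigma> p \<and> strict_mono_on {1..k} p \<longleftrightarrow>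
    (\<forall>i\<in>{1..k}. \<forall>j\<in>{1..k}. (i < j \<longrightarrow> p i < p j) \<and> (\<tau> i < \<tau> j \<longrightarrow> \<sigma> (p i) < \<sigma> (p j))) \<and>
    (\<forall>a\<in>{1..n}. (\<forall>i\<in>{1..k}. p i \<noteq> a) \<longrightarrow>
       (\<forall>i\<in>{1..k}. p (\<tau> i) < a \<longleftrightarrow> \<sigma> (p i) < \<sigma> a) \<and>
       (\<forall>b\<in>{1..n}. (\<forall>i\<in>{1..k}. p i \<noteq> b) \<longrightarrow> a < b \<longrightarrow> \<sigma> a < \<sigma> b))" (is "?L \<longleftrightarrow> ?R")
proof
  have \<tau>_mem: "\<tau> i \<in> {1..k} \<longleftrightarrow> i \<in> {1..k}" for i using permutes_in_image[OF \<tau>] .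
  show ?R if L: ?L
  proof -
    have move: "\<sigma> (p i) = p (\<tau> i)" if "i \<in> {1..k}" for i using L that by (simp add: moved_by_def)
    have other: "\<sigma> a = a" if "a \<in> {1..n}" "\<forall>i\<in>{1..k}. p i \<noteq> a" for a
    proof -
      have "a \<notin> p ` {1..k}" using that(2) by blast
      then show ?thesis using L that(1) by (simp add: moved_by_def)
    qed
    have mono: "p i < p j" if "i \<in> {1..k}" "j \<in> {1..k}" "i < j" for i j
      using L that unfolding strict_mono_on_def by blast
    have "\<sigma> (p i) < \<sigma> (p j)" if "i \<in> {1..k}" "j \<in> {1..k}" "\<tau> i < \<tau> j" for i j
      using mono[OF \<tau>_mem[THEN iffD2, OF that(1)] \<tau>_mem[THEN iffD2, OF that(2)] that(3)]
      by (simp only: move[OF that(1)] move[OF that(2)])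
    moreover have "p (\<tau> i) < a \<longleftrightarrow> \<sigma> (p i) < \<sigma> a"
      if "a \<in> {1..n}" "\<forall>i\<in>{1..k}. p i \<noteq> a" "i \<in> {1..k}" for a i
      by (simp only: move[OF that(3)] other[OF that(1,2)])
    moreover have "\<sigma> a < \<sigma> b" if "a \<in> {1..n}" "\<forall>i\<in>{1..k}. p i \<noteq> a"
      "b \<in> {1..n}" "\<forall>i\<in>{1..k}. p i \<noteq> b" "a < b" for a b
      by (simp only: other[OF that(1,2)] other[OF that(3,4)] that(5))
    ultimately show ?thesis using mono by blast
  qed
  assume R: ?R
  have R1: "p i < p j" if "i \<in> {1..k}" "j \<in> {1..k}" "i < j" for i j using R that by blast
  have R2: "\<sigma> (p i) < \<sigma> (p j)" if "i \<in> {1..k}" "j \<in> {1..k}" "\<tau> i < \<tau> j" for i j using R that by blast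
  have not_image: "\<forall>i\<in>{1..k}. p i \<noteq> z" if "z \<notin> p ` {1..k}" for z using that by blast
  have R': "(\<forall>i\<in>{1..k}. p (\<tau> i) < a \<longleftrightarrow> \<sigma> (p i) < \<sigma> a) \<and>
      (\<forall>b\<in>{1..n}. (\<forall>i\<in>{1..k}. p i \<noteq> b) \<longrightarrow> a < b \<longrightarrow> \<sigma> a < \<sigma> b)"
    if "a \<in> {1..n}" "a \<notin> p ` {1..k}" for a
    using R that(1) not_image[OF that(2)] by simp
  have R3: "p (\<tau> i) < a \<longleftrightarrow> \<sigma> (p i) < \<sigma> a" if "a \<in> {1..n}" "a \<notin> p ` {1..k}" "i \<in> {1..k}" for a i
    using R'[OF that(1,2)] that(3) by blast
  have R4: "\<sigma> a < \<sigma> b" if "a \<in> {1..n}" "a \<notin> p ` {1..k}" "b \<in> {1..n}" "b \<notin> p ` {1..k}" "a < b" for a b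
    using R'[OF that(1,2)] not_image[OF that(4)] that(3,5) by blast
  have mono: "strict_mono_on {1..k} p" unfolding strict_mono_on_def using R1 by blast
  then have inj: "inj_on p {1..k}" by (rule strict_mono_on_imp_inj_on)
  have sub: "p ` {1..k} \<subseteq> {1..n}" using p by auto
  \<comment> \<open>The permutation that the pattern is meant to describe. The order conditions make
    it rank values as \<open>\<sigma>\<close> does, and rigidity yields equality.\<close>
  define \<sigma>' where "\<sigma>' x = (if x \<in> p ` {1..k} then p (\<tau> (inv_into {1..k} p x)) else x)" for x
  have \<sigma>'_p: "\<sigma>' (p i) = p (\<tau> i)" if "i \<in> {1..k}" for i using that inj by (simp add: \<sigma>'_def)
  have \<sigma>'_other: "\<sigma>' x = x" if "x \<notin> p ` {1..k}" for x using that by (simp add: \<sigma>'_def)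
  have "bij_betw \<sigma>' (p ` {1..k}) (p ` {1..k})"
  proof -
    have "bij_betw (p \<circ> (\<tau> \<circ> inv_into {1..k} p)) (p ` {1..k}) (p ` {1..k})"
      using inj permutes_imp_bij[OF \<tau>] by (intro bij_betw_trans[of _ _ "{1..k}"] bij_betw_inv_into) (auto simp: bij_betw_def)
    moreover have "bij_betw \<sigma>' (p ` {1..k}) (p ` {1..k}) \<longleftrightarrow>
        bij_betw (p \<circ> (\<tau> \<circ> inv_into {1..k} p)) (p ` {1..k}) (p ` {1..k})"
      by (rule bij_betw_cong) (simp add: \<sigma>'_def)
    ultimately show ?thesis by blast
  qed
  then have "\<sigma>' permutes p ` {1..k}" by (rule bij_imp_permutes) (rule \<sigma>'_other)
  then have \<sigma>'_perm: "\<sigma>' permutes {1..n}" by (rule permutes_subset) (rule sub)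
  have "\<sigma>' = \<sigma>"
  proof (rule permutes_eq_if_order_eq[OF \<sigma> \<sigma>'_perm])
    fix x y assume xy: "x \<in> {1..n}" "y \<in> {1..n}" "\<sigma> x < \<sigma> y"
    show "\<sigma>' x < \<sigma>' y"
    proof (cases "x \<in> p ` {1..k}"; cases "y \<in> p ` {1..k}")
      assume "x \<in> p ` {1..k}" "y \<in> p ` {1..k}"
      then obtain i j where ij: "x = p i" "i \<in> {1..k}" "y = p j" "j \<in> {1..k}" by blast
      have "\<not> \<tau> j < \<tau> i" using R2[OF ij(4,2)] ij(1,3) xy(3) by auto
      moreover have "\<tau> i \<noteq> \<tau> j"
        using xy(3) ij permutes_inj[OF \<tau>] by (auto dest: injD)
      ultimately have "p (\<tau> i) < p (\<tau> j)" 
        using R1[OF \<tau>_mem[THEN iffD2, OF ij(2)] \<tau>_mem[THEN iffD2, OF ij(4)]] by simp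
      then show ?thesis by (simp only: ij(1,3) \<sigma>'_p[OF ij(2)] \<sigma>'_p[OF ij(4)])
    next
      assume "x \<in> p ` {1..k}" and y: "y \<notin> p ` {1..k}"
      then obtain i where i: "x = p i" "i \<in> {1..k}" by blast
      have "p (\<tau> i) < y" using R3[OF xy(2) y i(2)] xy(3) i(1) by simp
      then show ?thesis by (simp only: i(1) \<sigma>'_p[OF i(2)] \<sigma>'_other[OF y])
    next
      assume x: "x \<notin> p ` {1..k}" and "y \<in> p ` {1..k}"
      then obtain i where i: "y = p i" "i \<in> {1..k}" by blast
      have "\<not> \<sigma> (p i) < \<sigma> x" using xy(3) i by simp
      then have "\<not> p (\<tau> i) < x" using R3[OF xy(1) x i(2)] by simp
      moreover have "p (\<tau> i) \<noteq> x" using x i \<tau>_mem by blast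
      ultimately have "x < p (\<tau> i)" by simp
      then show ?thesis by (simp only: i(1) \<sigma>'_p[OF i(2)] \<sigma>'_other[OF x])
    next
      assume *: "x \<notin> p ` {1..k}" "y \<notin> p ` {1..k}"
      have "\<not> y < x"
      proof
        assume "y < x"
        then have "\<sigma> y < \<sigma> x" using R4[OF xy(2) *(2) xy(1) *(1)] by simp
        then show False using xy(3) by simp
      qed
      moreover have "x \<noteq> y" using xy(3) by blast
      ultimately have "x < y" by simp
      then show ?thesis by (simp only: *[THEN \<sigma>'_other])
    qed
  qed
  show ?L using mono inj p \<sigma>'_p \<sigma>'_other unfolding moved_by_def \<open>\<sigma>' = \<sigma>\<close> by blast
qed

lemma toto_definable_sorted:
  assumes \<tau>: "\<tau> permutes {1..k}"
  shows "toto_definable {(n, \<sigma>) \<in> perms. \<exists>p. moved_by k \<tau> n \<sigma> p \<and> strict_mono_on {1..k} p}"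
proof (rule toto_definableI)
  have \<tau>_mem: "\<tau> i \<in> {1..k} \<longleftrightarrow> i \<in> {1..k}" for i using permutes_in_image[OF \<tau>] .
  have upd: "i \<in> {1..k} \<Longrightarrow> (v(Suc k := a)) i = v i" "i \<in> {1..k} \<Longrightarrow> (v(0 := a)) i = v i"
    "(v(Suc k := a)) 0 = v 0" "(v(x := a)) x = a" for i a x and v :: "nat \<Rightarrow> nat" by auto
  \<comment> \<open>Variables 1 to \<open>k\<close> carry \<open>p\<close>, variable 0 carries
    \<open>a\<close> and variable \<open>Suc k\<close> carries \<open>b\<close>. The predicates go
    from the innermost quantifier outwards.\<close>
  define P1 where "P1 = (\<lambda>(D :: nat set) I (v :: nat \<Rightarrow> nat).
    (\<forall>i\<in>{1..k}. \<not> v i = v (Suc k)) \<longrightarrow> I LessP (v 0) (v (Suc k)) \<longrightarrow> I LessV (v 0) (v (Suc k)))"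
  define P2 where "P2 = (\<lambda>(D :: nat set) I (v :: nat \<Rightarrow> nat). (\<forall>i\<in>{1..k}. \<not> v i = v 0) \<longrightarrow>
    (\<forall>i\<in>{1..k}. I LessP (v (\<tau> i)) (v 0) \<longleftrightarrow> I LessV (v i) (v 0)) \<and>
    (\<forall>b\<in>D. (\<forall>i\<in>{1..k}. \<not> v i = b) \<longrightarrow> I LessP (v 0) b \<longrightarrow> I LessV (v 0) b))"
  define P3 where "P3 = (\<lambda>(D :: nat set) I (v :: nat \<Rightarrow> nat).
    (\<forall>i\<in>{1..k}. \<forall>j\<in>{1..k}. (i < j \<longrightarrow> I LessP (v i) (v j)) \<and> (\<tau> i < \<tau> j \<longrightarrow> I LessV (v i) (v j))) \<and>
    (\<forall>a\<in>D. (\<forall>i\<in>{1..k}. \<not> v i = a) \<longrightarrow>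
      (\<forall>i\<in>{1..k}. I LessP (v (\<tau> i)) a \<longleftrightarrow> I LessV (v i) a) \<and>
      (\<forall>b\<in>D. (\<forall>i\<in>{1..k}. \<not> v i = b) \<longrightarrow> I LessP a b \<longrightarrow> I LessV a b)))"
  have "expressible (insert (Suc k) (insert 0 {1..k})) P1"
    unfolding P1_def
    by (intro expressible_imp expressible_ball expressible_not expressible_Eq expressible_Rel) auto
  then have "expressible (insert 0 {1..k})
    (\<lambda>(D :: nat set) I v. \<forall>b\<in>D. (\<forall>i\<in>{1..k}. \<not> v i = b) \<longrightarrow> I LessP (v 0) b \<longrightarrow> I LessV (v 0) b)"
    by (rule expressible_allI) (simp only: P1_def upd cong: ball_cong)
  then have "expressible (insert 0 {1..k}) P2"
    unfolding P2_def
    by (intro expressible_imp expressible_conj expressible_iff expressible_ball expressible_not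
        expressible_Eq expressible_Rel) (use \<tau>_mem in auto)
  then have "expressible {1..k} (\<lambda>(D :: nat set) I v. \<forall>a\<in>D. (\<forall>i\<in>{1..k}. \<not> v i = a) \<longrightarrow>
      (\<forall>i\<in>{1..k}. I LessP (v (\<tau> i)) a \<longleftrightarrow> I LessV (v i) a) \<and>
      (\<forall>b\<in>D. (\<forall>i\<in>{1..k}. \<not> v i = b) \<longrightarrow> I LessP a b \<longrightarrow> I LessV a b))"
    by (rule expressible_allI) (simp only: P2_def upd \<tau>_mem cong: ball_cong)
  then have "expressible {1..k} P3"
    unfolding P3_def
    by (intro expressible_conj expressible_ball expressible_const_imp expressible_Rel) auto
  then show "expressible {} (\<lambda>D I v. \<exists>p\<in>{1..k} \<rightarrow> D. P3 D I p)"
    by (rule expressible_exsI) (simp only: P3_def \<tau>_mem if_True cong: ball_cong)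
  show "(n, \<sigma>) \<in> {(n, \<sigma>) \<in> perms. \<exists>p. moved_by k \<tau> n \<sigma> p \<and> strict_mono_on {1..k} p} \<longleftrightarrow>
    (\<exists>p\<in>{1..k} \<rightarrow> {1..n}. P3 {1..n} (toto_pos_rel \<sigma>) p)" if "(n, \<sigma>) \<in> perms" for n \<sigma>
  proof -
    have "\<sigma> permutes {1..n}" using that by (simp add: perms_def)
    then have "P3 {1..n} (toto_pos_rel \<sigma>) p \<longleftrightarrow> moved_by k \<tau> n \<sigma> p \<and> strict_mono_on {1..k} p"
      if "p \<in> {1..k} \<rightarrow> {1..n}" for p
      using moved_by_iff_order[OF _ \<tau> that, of \<sigma>] by (simp add: P3_def)
    moreover have "p \<in> {1..k} \<rightarrow> {1..n}" if "moved_by k \<tau> n \<sigma> p" for p using that by (simp add: moved_by_def)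
    ultimately show ?thesis using that by blast
  qed
qed auto

text \<open>The listed points may follow one another in any relative order, so every pattern of size
  \<open>k\<close> and type \<open>\<mu>\<close> must be allowed; these are finitely many.\<close>

lemma toto_definable_\<D>:
  assumes "integer_partition \<mu>"
  shows "toto_definable (\<D> \<mu>)"
proof -
  obtain k \<tau> where \<tau>: "\<tau> permutes {1..k}" "cycle_type k \<tau> = \<mu>"
    using integer_partition_realizable[OF assms] by blast
  let ?T = "{\<tau>'. \<tau>' permutes {1..k} \<and> cycle_type k \<tau>' = \<mu>}"
  have "\<D> \<mu> = (\<Union>\<tau>'\<in>?T. {(n, \<sigma>) \<in> perms. \<exists>p. moved_by k \<tau>' n \<sigma> p \<and> strict_mono_on {1..k} p})"
  proof (intro equalityI subsetI)
    fix x assume "x \<in> \<D> \<mu>"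
    then obtain n \<sigma> q where x: "x = (n, \<sigma>)" "\<sigma> permutes {1..n}" "moved_by k \<tau> n \<sigma> q"
      using \<D>_eq_moved_by[OF \<tau>(1)] \<tau>(2) by (auto simp: perms_def)
    obtain \<tau>' p where "\<tau>' permutes {1..k}" "cycle_type k \<tau>' = cycle_type k \<tau>"
      "moved_by k \<tau>' n \<sigma> p" "strict_mono_on {1..k} p"
      using moved_by_sorted[OF x(2) \<tau>(1) x(3)] .
    then show "x \<in> (\<Union>\<tau>'\<in>?T. {(n, \<sigma>) \<in> perms. \<exists>p. moved_by k \<tau>' n \<sigma> p \<and> strict_mono_on {1..k} p})"
      using x(1,2) \<tau>(2) by (auto simp: perms_def)
  next
    fix x assume "x \<in> (\<Union>\<tau>'\<in>?T. {(n, \<sigma>) \<in> perms. \<exists>p. moved_by k \<tau>' n \<sigma> p \<and> strict_mono_on {1..k} p})"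
    then obtain \<tau>' where \<tau>': "\<tau>' permutes {1..k}" "cycle_type k \<tau>' = \<mu>"
      and "x \<in> {(n, \<sigma>) \<in> perms. \<exists>p. moved_by k \<tau>' n \<sigma> p}" by blast
    then show "x \<in> \<D> \<mu>" using \<D>_eq_moved_by[OF \<tau>'(1)] \<tau>'(2) by simp
  qed
  moreover have "finite ?T" by (rule finite_subset[OF _ finite_permutations[of "{1..k}"]]) auto
  ultimately show ?thesis using toto_definable_sorted toto_definable_UN by (metis (no_types, lifting) mem_Collect_eq)
qed

text \<open>\<open>SymR\<close> is the graph of the permutation, so \<open>moved_by\<close> for a
  single \<open>\<tau>\<close> of type \<open>\<mu>\<close> can be expressed as it stands.\<close>

lemma toob_definable_\<D>:
  assumes "integer_partition \<mu>"
  shows "toob_definable (\<D> \<mu>)"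
proof -
  obtain k \<tau> where \<tau>: "\<tau> permutes {1..k}" "cycle_type k \<tau> = \<mu>"
    using integer_partition_realizable[OF assms] by blast
  have \<tau>_mem: "\<tau> i \<in> {1..k} \<longleftrightarrow> i \<in> {1..k}" for i using permutes_in_image[OF \<tau>(1)] .
  have upd: "i \<in> {1..k} \<Longrightarrow> (v(0 := a)) i = v i" "(v(0 := a)) 0 = a"
    for i a and v :: "nat \<Rightarrow> nat" by auto
  define P1 where "P1 = (\<lambda>(D :: nat set) I (v :: nat \<Rightarrow> nat).
    (\<forall>i\<in>{1..k}. \<not> v i = v 0) \<longrightarrow> I SymR (v 0) (v 0))"
  define P2 where "P2 = (\<lambda>(D :: nat set) I (v :: nat \<Rightarrow> nat).
    (\<forall>i\<in>{1..k}. \<forall>j\<in>{1..k}. i \<noteq> j \<longrightarrow> \<not> v i = v j) \<and> (\<forall>i\<in>{1..k}. I SymR (v i) (v (\<tau> i))) \<and>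
    (\<forall>a\<in>D. (\<forall>i\<in>{1..k}. \<not> v i = a) \<longrightarrow> I SymR a a))"
  have "expressible (insert 0 {1..k}) P1"
    unfolding P1_def
    by (intro expressible_imp expressible_ball expressible_not expressible_Eq expressible_Rel) auto
  then have "expressible {1..k} (\<lambda>(D :: nat set) I v. \<forall>a\<in>D. (\<forall>i\<in>{1..k}. \<not> v i = a) \<longrightarrow> I SymR a a)"
    by (rule expressible_allI) (simp only: P1_def upd cong: ball_cong)
  then have "expressible {1..k} P2"
    unfolding P2_def
    by (intro expressible_conj expressible_ball expressible_const_imp expressible_not expressible_Eq
        expressible_Rel) (use \<tau>_mem in auto)
  then have *: "expressible {} (\<lambda>D I v. \<exists>p\<in>{1..k} \<rightarrow> D. P2 D I p)"
    by (rule expressible_exsI) (simp only: P2_def \<tau>_mem if_True cong: ball_cong)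
  show ?thesis
  proof (rule toob_definableI[OF *])
    fix n \<sigma> assume "(n, \<sigma>) \<in> perms"
    have "P2 {1..n} (toob_rel \<sigma>) p \<longleftrightarrow> moved_by k \<tau> n \<sigma> p" if "p \<in> {1..k} \<rightarrow> {1..n}" for p
      using that by (auto simp: P2_def moved_by_def inj_on_def)
    moreover have "p \<in> {1..k} \<rightarrow> {1..n}" if "moved_by k \<tau> n \<sigma> p" for p using that by (simp add: moved_by_def)
    ultimately show "(n, \<sigma>) \<in> \<D> \<mu> \<longleftrightarrow> (\<exists>p\<in>{1..k} \<rightarrow> {1..n}. P2 {1..n} (toob_rel \<sigma>) p)"
      using \<D>_eq_moved_by[OF \<tau>(1)] \<tau>(2) \<open>(n, \<sigma>) \<in> perms\<close> by auto
  qed (auto simp: \<D>_def \<C>_def)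
qed

lemma expressible_size_ge:
  "expressible {} (\<lambda>(D :: 'a set) (I :: 'r \<Rightarrow> 'a \<Rightarrow> 'a \<Rightarrow> bool) v. \<exists>p\<in>{1..k :: nat} \<rightarrow> D. inj_on p {1..k})"
proof (rule expressible_exsI)
  show "expressible {1..k} (\<lambda>(D :: 'a set) (I :: 'r \<Rightarrow> 'a \<Rightarrow> 'a \<Rightarrow> bool) v.
      \<forall>i\<in>{1..k}. \<forall>j\<in>{1..k}. i \<noteq> j \<longrightarrow> \<not> v i = v j)"
    by (intro expressible_ball expressible_const_imp expressible_not expressible_Eq) auto
qed (auto simp: inj_on_def)

lemma size_ge_iff: "(\<exists>p\<in>{1..k} \<rightarrow> {1..n}. inj_on p {1..k}) \<longleftrightarrow> k \<le> (n :: nat)"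
proof
  assume "\<exists>p\<in>{1..k} \<rightarrow> {1..n}. inj_on p {1..k}"
  then show "k \<le> n" using card_inj[of _ "{1..k}" "{1..n}"] by auto
next
  assume "k \<le> n"
  then show "\<exists>p\<in>{1..k} \<rightarrow> {1..n}. inj_on p {1..k}" by (intro bexI[of _ id]) auto
qed

lemma toto_toob_set_size_ge: "toto_toob_set {(n, \<sigma>) \<in> perms. k \<le> n}"
  unfolding toto_toob_set_iff
proof
  show "toto_definable {(n, \<sigma>) \<in> perms. k \<le> n}"
    by (rule toto_definableI[OF expressible_size_ge[of k]]) (auto simp only: size_ge_iff mem_Collect_eq split)
  show "toob_definable {(n, \<sigma>) \<in> perms. k \<le> n}"
    by (rule toob_definableI[OF expressible_size_ge[of k]]) (auto simp only: size_ge_iff mem_Collect_eq split)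
qed

lemma toto_toob_set_\<D>: "integer_partition \<mu> \<Longrightarrow> toto_toob_set (\<D> \<mu>)"
  by (simp add: toto_toob_set_iff toto_definable_\<D> toob_definable_\<D>)

text \<open>Members of \<open>\<D> \<mu>\<close> have size \<open>k + j\<close> with
  \<open>j\<close> extra fixed points, so excluding sizes above \<open>k\<close> leaves exactly
  \<open>\<C> \<mu>\<close>.\<close>

lemma toto_toob_set_\<C>:
  assumes "integer_partition \<mu>"
  shows "toto_toob_set (\<C> \<mu>)"
proof -
  obtain k \<tau> where \<tau>: "\<tau> permutes {1..k}" "cycle_type k \<tau> = \<mu>"
    using integer_partition_realizable[OF assms] by blast
  interpret algebra perms "{E. toto_toob_set E}" by (rule algebra_toto_toob)
  have "\<C> \<mu> = \<D> \<mu> - {(n, \<sigma>) \<in> perms. Suc k \<le> n}"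
  proof (intro equalityI subsetI)
    fix x assume "x \<in> \<C> \<mu>"
    then obtain n \<sigma> where x: "x = (n, \<sigma>)" "\<sigma> permutes {1..n}" "cycle_type n \<sigma> = \<mu>"
      by (auto simp: \<C>_def perms_def)
    then have "n = k" using moved_by_if_cycle_type[OF \<tau>(1) x(2), of 0] \<tau>(2) by auto
    moreover have "\<C> \<mu> \<subseteq> \<D> \<mu>"
    proof -
      have "\<C> (\<mu> + replicate_mset 0 1) \<subseteq> \<D> \<mu>" unfolding \<D>_def by blast
      then show ?thesis by simp
    qed
    ultimately show "x \<in> \<D> \<mu> - {(n, \<sigma>) \<in> perms. Suc k \<le> n}" using x(1) \<open>x \<in> \<C> \<mu>\<close> by auto
  next
    fix x assume "x \<in> \<D> \<mu> - {(n, \<sigma>) \<in> perms. Suc k \<le> n}"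
    then have "x \<in> \<D> \<mu>" "x \<notin> {(n, \<sigma>) \<in> perms. Suc k \<le> n}" by blast+
    then obtain n \<sigma> j where x: "x = (n, \<sigma>)" "\<sigma> permutes {1..n}" "n \<le> k"
      "cycle_type n \<sigma> = \<mu> + replicate_mset j 1"
      unfolding \<D>_def \<C>_def perms_def by fastforce
    then have "n = k + j" using moved_by_if_cycle_type[OF \<tau>(1) x(2), of j] \<tau>(2) by auto
    then show "x \<in> \<C> \<mu>" using x by (simp add: \<C>_def perms_def)
  qed
  then show ?thesis using Diff[of "\<D> \<mu>"] toto_toob_set_\<D>[OF assms] toto_toob_set_size_ge by simp
qed

lemma toto_toob_set_if_generated:
  assumes "E \<in> generated_algebra perms
    ({\<C> \<mu> | \<mu>. integer_partition \<mu>} \<union> {\<D> \<mu> | \<mu>. integer_partition \<mu>})"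
  shows "toto_toob_set E"
proof -
  have "{\<C> \<mu> | \<mu>. integer_partition \<mu>} \<union> {\<D> \<mu> | \<mu>. integer_partition \<mu>} \<subseteq> {E. toto_toob_set E}"
    using toto_toob_set_\<C> toto_toob_set_\<D> by blast
  then show ?thesis using assms algebra_toto_toob unfolding generated_algebra_def by blast
qed

section \<open>Conjugacy-invariant sets closed under stretching of runs\<close>

text \<open>What the games say about cycle types alone: \<open>F\<close> will consist of the cycle
  types of a definable set, \<open>\<mu>\<close> is the type of the permutation in front of the
  runs, and \<open>M\<close> is the length from which on runs are interchangeable.\<close>

locale run_invariant =
  fixes F :: "nat multiset set" and M :: nat
  assumes pos: "0 < M"
    and rotation: "\<And>\<mu> a a' b b'. \<lbrakk>integer_partition \<mu>; a = a' \<or> M \<le> a \<and> M \<le> a'; b = b' \<or> M \<le> b \<and> M \<le> b'\<rbrakk> \<Longrightarrow>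
      \<mu> + replicate_mset (gcd a b) ((a + b) div gcd a b) \<in> F \<longleftrightarrow>
      \<mu> + replicate_mset (gcd a' b') ((a' + b') div gcd a' b') \<in> F"
    and reversal: "\<And>\<mu> m m'. \<lbrakk>integer_partition \<mu>; M \<le> m; M \<le> m'\<rbrakk> \<Longrightarrow>
      \<mu> + (replicate_mset (m div 2) 2 + replicate_mset (m mod 2) 1) \<in> F \<longleftrightarrow>
      \<mu> + (replicate_mset (m' div 2) 2 + replicate_mset (m' mod 2) 1) \<in> F"
begin

text \<open>With an empty second block \<open>gcd m 0 = m\<close>, and the rotation is made of
  \<open>m\<close> fixed points.\<close>

lemma fixed_points:
  assumes "integer_partition \<mu>" "M \<le> m" "M \<le> m'"
  shows "\<mu> + replicate_mset m 1 \<in> F \<longleftrightarrow> \<mu> + replicate_mset m' 1 \<in> F"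
  using rotation[OF assms(1), of m m' 0 0] assms(2,3) pos by simp

lemma long_cycle:
  assumes "integer_partition \<mu>" "M < m" "M < m'"
  shows "add_mset m \<mu> \<in> F \<longleftrightarrow> add_mset m' \<mu> \<in> F"
proof -
  have "M \<le> m - 1" "M \<le> m' - 1" "m - 1 + 1 = m" "m' - 1 + 1 = m'" using assms(2,3) by simp_all
  then show ?thesis using rotation[OF assms(1), of "m - 1" "m' - 1" 1 1] by simp
qed

text \<open>Blocks of lengths \<open>(d - 1) * m\<close> and \<open>m\<close> rotate in
  \<open>m\<close> cycles of length \<open>d\<close>. Both are at least \<open>M\<close> because
  \<open>d\<close> is at least 2, so they may be replaced by two blocks of length
  \<open>M\<close>.\<close>

lemma many_equal_cycles:
  assumes "integer_partition \<mu>" "2 \<le> d" "M \<le> m"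
  shows "\<mu> + replicate_mset m d \<in> F \<longleftrightarrow> \<mu> + replicate_mset M 2 \<in> F"
proof -
  obtain e where d: "d = Suc e" "1 \<le> e" using assms(2) by (cases d) auto
  have "M \<le> e * m" using d(2) assms(3) by (metis le_trans mult.commute mult_le_mono2 nat_mult_1_right)
  moreover have "(e * m + m) div m = d" using pos assms(3) d(1) by simp
  moreover have "(M + M) div M = 2" using pos by (simp flip: mult_2)
  ultimately show ?thesis using rotation[OF assms(1), of "e * m" M m M] assms(3) by simp
qed

text \<open>Blocks of the coprime lengths \<open>M + 1\<close> and \<open>M\<close> form a single
  cycle, two blocks of length \<open>M\<close> form \<open>M\<close> transpositions.\<close>

lemma long_cycle_iff_many:
  assumes "integer_partition \<mu>" "M < m"
  shows "add_mset m \<mu> \<in> F \<longleftrightarrow> \<mu> + replicate_mset M 2 \<in> F"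
proof -
  have "(M + M) div M = 2" using pos by (simp flip: mult_2)
  moreover have "gcd (M + 1) M = 1" by simp
  ultimately have "add_mset (M + 1 + M) \<mu> \<in> F \<longleftrightarrow> \<mu> + replicate_mset M 2 \<in> F"
    using rotation[OF assms(1), of "M + 1" M M M] by simp
  then show ?thesis using long_cycle[OF assms, of "M + 1 + M"] pos by simp
qed

text \<open>Reversals of lengths \<open>2 * M + 1\<close> and \<open>2 * M\<close> both have
  \<open>M\<close> transpositions and differ by the middle point.\<close>

lemma absorb_fixed_point:
  assumes "integer_partition \<mu>"
  shows "add_mset 1 (\<mu> + replicate_mset M 2) \<in> F \<longleftrightarrow> \<mu> + replicate_mset M 2 \<in> F"
  using reversal[OF assms, of "2 * M + 1" "2 * M"] by simp

lemma absorb: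
  assumes "integer_partition \<mu>"
  shows "\<mu> + replicate_mset M 2 \<in> F \<longleftrightarrow> replicate_mset M 2 \<in> F"
  using assms
proof (induction \<mu>)
  case (add l \<mu>)
  then have \<mu>: "integer_partition \<mu>" "0 < l" by (auto simp: integer_partition_def)
  have "add_mset l \<mu> + replicate_mset M 2 \<in> F \<longleftrightarrow> \<mu> + replicate_mset M 2 \<in> F"
  proof (cases "l = 1")
    case True
    then show ?thesis using absorb_fixed_point[OF \<mu>(1)] by simp
  next
    case False
    then have l: "2 \<le> l" using \<mu>(2) by simp
    have "add_mset l \<mu> + replicate_mset M 2 \<in> F \<longleftrightarrow> add_mset l \<mu> + replicate_mset M l \<in> F"
      using many_equal_cycles[OF add.prems l, of M] by simp
    \<comment> \<open>With the transpositions turned into cycles of length \<open>l\<close>, the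
      extra cycle only raises their number to \<open>M + 1\<close>, which turns back into
      \<open>M\<close> transpositions.\<close>
    also have "add_mset l \<mu> + replicate_mset M l = \<mu> + replicate_mset (Suc M) l" by simp
    also have "\<dots> \<in> F \<longleftrightarrow> \<mu> + replicate_mset M 2 \<in> F"
      using many_equal_cycles[OF \<mu>(1) l, of "Suc M"] by simp
    finally show ?thesis .
  qed
  then show ?case using add.IH \<mu>(1) by simp
qed simp

lemma large:
  assumes "integer_partition \<mu>" and "(\<exists>l\<in>#\<mu>. M < l) \<or> (\<exists>l\<ge>2. M \<le> count \<mu> l)"
  shows "\<mu> \<in> F \<longleftrightarrow> replicate_mset M 2 \<in> F"
  using assms(2)
proof (elim disjE bexE exE conjE)
  fix l assume "l \<in># \<mu>" "M < l"
  then obtain \<nu> where \<nu>: "\<mu> = add_mset l \<nu>" by (metis multi_member_split)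
  then have "integer_partition \<nu>" using assms(1) by (auto simp: integer_partition_def)
  then show ?thesis using long_cycle_iff_many[OF _ \<open>M < l\<close>, of \<nu>] absorb \<nu> by simp
next
  fix l assume "2 \<le> l" "M \<le> count \<mu> l"
  then obtain \<nu> where \<nu>: "\<mu> = \<nu> + replicate_mset M l"
    by (metis count_le_replicate_mset_subset_eq subset_mset.diff_add)
  then have "integer_partition \<nu>" using assms(1) by (auto simp: integer_partition_def)
  then show ?thesis using many_equal_cycles[OF _ \<open>2 \<le> l\<close>, of \<nu> M] absorb \<nu> by simp
qed

text \<open>Contains every type without parts 1 that escapes \<open>large\<close>: its parts lie in
  \<open>{2..M}\<close> and none occurs \<open>M\<close> times. The size bound is crude; what counts
  is finiteness.\<close>

definition small :: "nat multiset set" where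
  "small = (\<Union>n\<le>M * M. multisets_of_size {2..M} n)"

lemma finite_small: "finite small"
  by (auto simp: small_def)

lemma integer_partition_small: "\<mu> \<in> small \<Longrightarrow> integer_partition \<mu>"
  by (auto simp: small_def multisets_of_size_def integer_partition_def)

lemma not_small:
  assumes "integer_partition \<mu>" "1 \<notin># \<mu>" "\<mu> \<notin> small"
  shows "(\<exists>l\<in>#\<mu>. M < l) \<or> (\<exists>l\<ge>2. M \<le> count \<mu> l)"
proof (rule ccontr)
  assume "\<not> ?thesis"
  then have le: "\<And>l. l \<in># \<mu> \<Longrightarrow> l \<le> M" and count: "\<And>l. 2 \<le> l \<Longrightarrow> count \<mu> l < M"
    by (meson not_le)+
  have ge: "2 \<le> l" if "l \<in># \<mu>" for l
  proof -
    have "l \<noteq> 0" using assms(1) that unfolding integer_partition_def by metis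
    moreover have "l \<noteq> 1" using assms(2) that by metis
    ultimately show ?thesis by simp
  qed
  have sub: "set_mset \<mu> \<subseteq> {2..M}" using le ge by auto
  then have "card (set_mset \<mu>) \<le> card {2..M}" by (intro card_mono) auto
  then have "card (set_mset \<mu>) \<le> M" by simp
  moreover have "size \<mu> \<le> card (set_mset \<mu>) * M"
    unfolding size_multiset_overloaded_eq
    using sum_bounded_above[of "set_mset \<mu>" "count \<mu>" M] count ge by (simp add: less_imp_le)
  ultimately have "size \<mu> \<le> M * M" by (meson le_trans mult_le_mono1)
  then show False using assms(3) sub by (auto simp: small_def multisets_of_size_def)
qed

text \<open>Stated for any algebra that contains the generators, because the generated one is the
  intersection of all these.\<close>

lemma algebra_member:
  assumes "algebra perms \<A>" and gen: "\<And>\<mu>. integer_partition \<mu> \<Longrightarrow> \<C> \<mu> \<in> \<A> \<and> \<D> \<mu> \<in> \<A>"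
  shows "{(n, \<sigma>) \<in> perms. cycle_type n \<sigma> \<in> F} \<in> \<A>" 
proof -
  define E where "E = {(n, \<sigma>) \<in> perms. cycle_type n \<sigma> \<in> F}"
  interpret algebra perms \<A> by fact
  have part: "integer_partition (\<mu> + replicate_mset j 1)" if "integer_partition \<mu>" for \<mu> j
    using that by (auto simp: integer_partition_def)
  have D: "E \<inter> \<D> \<mu> \<in> \<A>" if \<mu>: "integer_partition \<mu>" for \<mu>
  proof -
    let ?U = "\<lambda>J. \<Union>j\<in>J. \<C> (\<mu> + replicate_mset j 1)"
    have U: "?U J \<in> \<A>" if "finite J" for J
      by (rule finite_UN) (use that gen part[OF \<mu>] in auto)
    let ?J = "{j. j < M \<and> \<mu> + replicate_mset j 1 \<in> F}"
    \<comment> \<open>With fewer than \<open>M\<close> added fixed points the types are listed one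
      by one; from \<open>M\<close> on they are all in \<open>F\<close> or all outside, and this
      tail is \<open>\<D> \<mu>\<close> without its first \<open>M\<close> classes.\<close>
    have eq: "E \<inter> \<D> \<mu> = ?U ?J \<union> (if \<mu> + replicate_mset M 1 \<in> F then \<D> \<mu> - ?U {..<M} else {})"
    proof (intro set_eqI)
      fix x :: "nat \<times> (nat \<Rightarrow> nat)"
      show "x \<in> E \<inter> \<D> \<mu> \<longleftrightarrow>
        x \<in> ?U ?J \<union> (if \<mu> + replicate_mset M 1 \<in> F then \<D> \<mu> - ?U {..<M} else {})"
      proof (cases "\<exists>n \<sigma> j. x = (n, \<sigma>) \<and> x \<in> perms \<and> cycle_type n \<sigma> = \<mu> + replicate_mset j 1")
        case True
        then obtain n \<sigma> j where x: "x = (n, \<sigma>)" "x \<in> perms" "cycle_type n \<sigma> = \<mu> + replicate_mset j 1"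
          by blast
        have C: "x \<in> \<C> (\<mu> + replicate_mset i 1) \<longleftrightarrow> i = j" for i
        proof -
          have "replicate_mset j (1 :: nat) = replicate_mset i 1 \<longleftrightarrow> i = j"
            by (metis size_replicate_mset)
          then show ?thesis using x by (simp add: \<C>_def)
        qed
        then have D: "x \<in> \<D> \<mu>" unfolding \<D>_def by blast
        have E: "x \<in> E \<longleftrightarrow> \<mu> + replicate_mset j 1 \<in> F" using x by (simp add: E_def)
        have stable: "\<mu> + replicate_mset j 1 \<in> F \<longleftrightarrow> \<mu> + replicate_mset M 1 \<in> F" if "\<not> j < M"
          using fixed_points[OF \<mu>, of j M] that by simp
        have U: "x \<in> ?U J \<longleftrightarrow> j \<in> J" for J by (simp only: UN_iff C) blast
        show ?thesis
          by (cases "\<mu> + replicate_mset M 1 \<in> F"; cases "j < M")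
            (simp_all only: Int_iff Un_iff Diff_iff D E U stable mem_Collect_eq lessThan_iff empty_iff
              if_True if_False simp_thms)
      next
        case False
        then have "x \<notin> \<C> (\<mu> + replicate_mset j 1)" for j by (auto simp: \<C>_def)
        then have "x \<notin> \<D> \<mu>" "x \<notin> ?U J" for J unfolding \<D>_def by blast+
        then show ?thesis by (simp only: Int_iff Un_iff Diff_iff empty_iff simp_thms split: if_split)
      qed
    qed
    have "\<D> \<mu> - ?U {..<M} \<in> \<A>" using gen[OF \<mu>] U[of "{..<M}"] by blast
    then have "(if \<mu> + replicate_mset M 1 \<in> F then \<D> \<mu> - ?U {..<M} else {}) \<in> \<A>"
      by (simp only: empty_sets split: if_split) blast
    moreover have "?U ?J \<in> \<A>" by (rule U) simp
    ultimately show ?thesis unfolding eq by (rule Un[rotated])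
  qed
  let ?S = "\<Union>\<mu>\<in>small. \<D> \<mu>"
  have outside: "(n, \<sigma>) \<in> E \<longleftrightarrow> replicate_mset M 2 \<in> F" if "(n, \<sigma>) \<in> perms" "(n, \<sigma>) \<notin> ?S" for n \<sigma>
  proof -
    \<comment> \<open>Every permutation lies in \<open>\<D>\<close> of its cycle type stripped of
      all fixed points; avoiding the sets \<open>\<D>\<close> of small types thus means that the
      stripped type is not small.\<close>
    let ?\<mu> = "filter_mset (\<lambda>l. l \<noteq> 1) (cycle_type n \<sigma>)" and ?j = "count (cycle_type n \<sigma>) 1"
    have eq: "cycle_type n \<sigma> = ?\<mu> + replicate_mset ?j 1"
      using multiset_partition[of "cycle_type n \<sigma>" "\<lambda>l. l \<noteq> 1"] by (simp add: filter_eq_replicate_mset)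
    have ct: "integer_partition (cycle_type n \<sigma>)"
      using that(1) integer_partition_cycle_type by (simp add: perms_def)
    then have \<mu>: "integer_partition ?\<mu>" "1 \<notin># ?\<mu>" by (auto simp: integer_partition_def)
    have "(n, \<sigma>) \<in> \<C> (?\<mu> + replicate_mset ?j 1)" using eq that(1) unfolding \<C>_def by simp
    then have "(n, \<sigma>) \<in> \<D> ?\<mu>" unfolding \<D>_def by blast
    then have "?\<mu> \<notin> small" using that(2) by blast
    \<comment> \<open>Long parts and frequent parts of length at least 2 survive when the fixed
      points are put back, so \<open>large\<close> applies to the full cycle type.\<close>
    from not_small[OF \<mu> this] have "(\<exists>l\<in>#cycle_type n \<sigma>. M < l) \<or> (\<exists>l\<ge>2. M \<le> count (cycle_type n \<sigma>) l)"
    proof (elim disjE bexE exE conjE)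
      fix l assume "2 \<le> l" "M \<le> count ?\<mu> l"
      then show ?thesis by (intro disjI2 exI[of _ l]) simp
    qed auto
    from large[OF ct this] show ?thesis using that(1) by (simp add: E_def)
  qed
  have S: "?S \<in> \<A>" by (rule finite_UN) (use finite_small gen integer_partition_small in auto)
  have eq: "E = (\<Union>\<mu>\<in>small. E \<inter> \<D> \<mu>) \<union> (if replicate_mset M 2 \<in> F then perms - ?S else {})"
  proof (intro set_eqI)
    fix x :: "nat \<times> (nat \<Rightarrow> nat)"
    have "x \<in> E \<longleftrightarrow> replicate_mset M 2 \<in> F" if "x \<in> perms" "x \<notin> ?S"
      using outside[of "fst x" "snd x"] that by simp
    moreover have "x \<in> E \<Longrightarrow> x \<in> perms" by (auto simp: E_def)
    ultimately show "x \<in> E \<longleftrightarrow>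
      x \<in> (\<Union>\<mu>\<in>small. E \<inter> \<D> \<mu>) \<union> (if replicate_mset M 2 \<in> F then perms - ?S else {})"
      by (cases "replicate_mset M 2 \<in> F") (simp_all only: if_True if_False, blast+)
  qed
  have "(if replicate_mset M 2 \<in> F then perms - ?S else {}) \<in> \<A>"
    using Diff[OF top S] by (simp only: empty_sets split: if_split) blast
  moreover have "(\<Union>\<mu>\<in>small. E \<inter> \<D> \<mu>) \<in> \<A>"
    by (rule finite_UN) (use finite_small D integer_partition_small in auto)
  ultimately have "E \<in> \<A>" by (subst eq) (rule Un[rotated])
  then show ?thesis by (simp only: E_def)
qed

end

section \<open>From definable sets to run-invariant families of cycle types\<close>

text \<open>Equal cycle types give a conjugating bijection, and this is an isomorphism of TOOB
  structures.\<close>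

lemma toob_definable_conjugation_invariant:
  assumes "toob_definable E" "(n, \<sigma>) \<in> perms" "(m, \<tau>) \<in> perms" "cycle_type n \<sigma> = cycle_type m \<tau>"
  shows "(n, \<sigma>) \<in> E \<longleftrightarrow> (m, \<tau>) \<in> E"
proof -
  obtain \<phi> where \<phi>: "sentence \<phi>" "toob_models \<phi> = E" using assms(1) by (auto simp: toob_definable_def)
  have perm: "\<sigma> permutes {1..n}" "\<tau> permutes {1..m}" using assms(2,3) by (simp_all add: perms_def)
  obtain f where f: "bij_betw f {1..n} {1..m}" "\<And>x. x \<in> {1..n} \<Longrightarrow> f (\<sigma> x) = \<tau> (f x)"
    by (rule conjugate_if_cycle_type_on_eq[of "{1..n}" "{1..m}" \<sigma> \<tau>])
       (use perm assms(4) in \<open>auto simp: cycle_type_eq\<close>)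
  have "satisfies {1..n} (toob_rel \<sigma>) \<phi> \<longleftrightarrow> satisfies {1..m} (toob_rel \<tau>) \<phi>"
  proof (rule satisfies_iso[OF f(1) \<phi>(1)])
    fix r x y assume xy: "x \<in> {1..n}" "y \<in> {1..n}"
    then have "\<sigma> x \<in> {1..n}" using permutes_in_image[OF perm(1)] by blast
    then have "\<sigma> x = y \<longleftrightarrow> f (\<sigma> x) = f y"
      using f(1) xy(2) unfolding bij_betw_def by (metis inj_on_eq_iff)
    then show "toob_rel \<sigma> r x y \<longleftrightarrow> toob_rel \<tau> r (f x) (f y)"
      by (cases r) (simp add: f(2)[OF xy(1)])
  qed
  then show ?thesis using assms(2,3) \<phi>(2) by (auto simp: toob_models_def)
qed

lemma toto_toob_set_run_invariant:
  assumes "toto_toob_set E"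
  obtains F M where "run_invariant F M" "E = {(n, \<sigma>) \<in> perms. cycle_type n \<sigma> \<in> F}"
proof -
  have toto: "toto_definable E" and toob: "toob_definable E" using assms by (simp_all add: toto_toob_set_iff)
  define F where "F = {cycle_type n \<sigma> | n \<sigma>. (n, \<sigma>) \<in> E}"
  have E_iff: "(n, \<sigma>) \<in> E \<longleftrightarrow> cycle_type n \<sigma> \<in> F" if "(n, \<sigma>) \<in> perms" for n \<sigma>
  proof
    assume "cycle_type n \<sigma> \<in> F"
    then obtain m \<tau> where "(m, \<tau>) \<in> E" "cycle_type n \<sigma> = cycle_type m \<tau>" unfolding F_def by blast
    moreover from this have "(m, \<tau>) \<in> perms" using toob_definable_subset[OF toob] by blast
    ultimately show "(n, \<sigma>) \<in> E" using toob_definable_conjugation_invariant[OF toob that] by blast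
  qed (auto simp: F_def)
  obtain \<phi> where \<phi>: "sentence \<phi>" "toto_models \<phi> = E" using toto by (auto simp: toto_definable_def)
  \<comment> \<open>The quantifier rank is the number of rounds; in \<open>k\<close> rounds, runs of
    at least \<open>2 ^ k\<close> points cannot be told apart.\<close>
  define M :: nat where "M = 2 ^ quantifier_rank \<phi>"
  have E_sat: "(n, \<sigma>) \<in> E \<longleftrightarrow> satisfies {1..n} (toto_pos_rel \<sigma>) \<phi>" if "(n, \<sigma>) \<in> perms" for n \<sigma>
    using that \<phi>(2) by (auto simp: toto_models_def satisfies_toto_dom[OF \<phi>(1)])
  have F_rotation: "cycle_type t \<tau> + replicate_mset (gcd a b) ((a + b) div gcd a b) \<in> F \<longleftrightarrow>
      satisfies (run_dom (rotation_lengths t a b)) (run_rel (rotation_order t \<tau>) (\<lambda>_ _. True)) \<phi>"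
    if "\<tau> permutes {1..t}" for t \<tau> a b
  proof -
    have "(t + (a + b), \<tau> \<circ> rotation t a b) \<in> perms"
      using direct_sum_rotation_permutes[OF that] by (simp add: perms_def)
    from E_iff[OF this] E_sat[OF this] show ?thesis
      unfolding cycle_type_direct_sum_rotation[OF that] satisfies_direct_sum_rotation[OF that \<phi>(1)] by blast
  qed
  have F_reversal: "cycle_type t \<tau> + (replicate_mset (m div 2) 2 + replicate_mset (m mod 2) 1) \<in> F \<longleftrightarrow>
      satisfies (run_dom (reversal_lengths t m)) (run_rel (toto_pos_rel \<tau>) (\<lambda>r _. r = LessP)) \<phi>"
    if "\<tau> permutes {1..t}" for t \<tau> m
  proof -
    have "(t + m, \<tau> \<circ> reversal t m) \<in> perms"
      using direct_sum_permutes[OF that reversal_permutes] by (simp add: perms_def)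
    from E_iff[OF this] E_sat[OF this] show ?thesis
      unfolding cycle_type_direct_sum_reversal[OF that] satisfies_direct_sum_reversal[OF that \<phi>(1)] by blast
  qed
  have "run_invariant F M"
  proof
    show "0 < M" by (simp add: M_def)
  next
    fix \<mu> and a a' b b' :: nat
    assume \<mu>: "integer_partition \<mu>" and len: "a = a' \<or> M \<le> a \<and> M \<le> a'" "b = b' \<or> M \<le> b \<and> M \<le> b'"
    \<comment> \<open>Any representative of \<open>\<mu>\<close> may stand in front of the runs,
      since membership in \<open>E\<close> depends on the cycle type only.\<close>
    obtain t \<tau> where \<tau>: "\<tau> permutes {1..t}" "cycle_type t \<tau> = \<mu>" using integer_partition_realizable[OF \<mu>] .
    show "\<mu> + replicate_mset (gcd a b) ((a + b) div gcd a b) \<in> F \<longleftrightarrow>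
      \<mu> + replicate_mset (gcd a' b') ((a' + b') div gcd a' b') \<in> F"
      unfolding \<tau>(2)[symmetric] F_rotation[OF \<tau>(1)]
      by (rule satisfies_run_equiv[OF \<phi>(1) order_refl]) (use len in \<open>auto simp: rotation_lengths_def M_def\<close>)
  next
    fix \<mu> and m m' :: nat assume \<mu>: "integer_partition \<mu>" and len: "M \<le> m" "M \<le> m'"
    obtain t \<tau> where \<tau>: "\<tau> permutes {1..t}" "cycle_type t \<tau> = \<mu>" using integer_partition_realizable[OF \<mu>] .
    show "\<mu> + (replicate_mset (m div 2) 2 + replicate_mset (m mod 2) 1) \<in> F \<longleftrightarrow>
      \<mu> + (replicate_mset (m' div 2) 2 + replicate_mset (m' mod 2) 1) \<in> F"
      unfolding \<tau>(2)[symmetric] F_reversal[OF \<tau>(1)]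
      by (rule satisfies_run_equiv[OF \<phi>(1) order_refl]) (use len in \<open>auto simp: reversal_lengths_def M_def\<close>)
  qed
  moreover have "E = {(n, \<sigma>) \<in> perms. cycle_type n \<sigma> \<in> F}"
    using E_iff toob_definable_subset[OF toob] by auto
  ultimately show ?thesis using that by blast
qed

theorem theorem6p3:
  fixes E :: "(nat \<times> (nat \<Rightarrow> nat)) set"
  assumes "E \<subseteq> perms"
  shows "toto_toob_set E \<longleftrightarrow>
    E \<in> generated_algebra perms
      ({\<C> \<mu> | \<mu>. integer_partition \<mu>} \<union> {\<D> \<mu> | \<mu>. integer_partition \<mu>})"
proof
  assume "toto_toob_set E"
  then obtain F M where "run_invariant F M" and E: "E = {(n, \<sigma>) \<in> perms. cycle_type n \<sigma> \<in> F}"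
    by (rule toto_toob_set_run_invariant)
  interpret run_invariant F M by fact
  show "E \<in> generated_algebra perms ({\<C> \<mu> | \<mu>. integer_partition \<mu>} \<union> {\<D> \<mu> | \<mu>. integer_partition \<mu>})"
    unfolding generated_algebra_def
  proof (rule InterI)
    fix \<A> assume *: "\<A> \<in> {\<A>. algebra perms \<A> \<and>
      {\<C> \<mu> | \<mu>. integer_partition \<mu>} \<union> {\<D> \<mu> | \<mu>. integer_partition \<mu>} \<subseteq> \<A>}"
    then have "algebra perms \<A>" by blast
    moreover have "\<C> \<mu> \<in> \<A> \<and> \<D> \<mu> \<in> \<A>" if "integer_partition \<mu>" for \<mu> using * that by blast
    ultimately show "E \<in> \<A>" unfolding E by (rule algebra_member)
  qed
qed (rule toto_toob_set_if_generated)

end
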